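(* Let $\mathcal{A}$ be a unital $C^*$-algebra and let $\mathcal{B}$ be a von Neumann algebra on a Hilbert space $\mathcal{G}$. For $i=1,2$ let $\phi_i:\mathcal{A}\to\mathcal{B}$ be a completely positive (CP) map with a GNS-representation $(F_i,y_i)$, where $F_i$ is a Hilbert $\mathcal{A}$-$\mathcal{B}$-module which is a von Neumann $\mathcal{B}$-module. Suppose that for some completely bounded map $\psi:\mathcal{A}\to\mathcal{B}$ the block map $$\Phi=\begin{pmatrix}\phi_1&\psi\\ \psi^*&\phi_2\end{pmatrix}:M_2(\mathcal{A})\to M_2(\mathcal{B}),\qquad \Phi\begin{pmatrix}a&b\\c&d\end{pmatrix}=\begin{pmatrix}\phi_1(a)&\psi(b)\\ \psi^*(c)&\phi_2(d)\end{pmatrix},$$ is completely positive. Then there is an adjointable bilinear contraction $T:F_2\to F_1$ such that $\psi(a)=\langle y_1,\,T a y_2\rangle$ for all $a\in\mathcal{A}$.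
   Context: For a linear map $\psi:\mathcal{A}\to\mathcal{B}$ between $C^*$-algebras, $\psi^*:\mathcal{A}\to\mathcal{B}$ is the linear map $\psi^*(a)=\psi(a^* )^*$. Hilbert spaces are complex and separable; all inner products are linear in the second variable. A Hilbert $\mathcal{B}$-module is a right $\mathcal{B}$-module with a $\mathcal{B}$-valued inner product, complete in the norm $\|x\|=\|\langle x,x\rangle\|^{1/2}$. A Hilbert $\mathcal{A}$-$\mathcal{B}$-module is a Hilbert $\mathcal{B}$-module with a nondegenerate left action of $\mathcal{A}$ (a $*$-homomorphism into the adjointable operators). A map between Hilbert $\mathcal{A}$-$\mathcal{B}$-modules is bilinear if it is left $\mathcal{A}$-linear and right $\mathcal{B}$-linear. If $\mathcal{B}\subseteq\mathscr{B}(\mathcal{G})$ is a von Neumann algebra and $E$ is a Hilbert $\mathcal{B}$-module, let $E\odot\mathcal{G}$ be the Hilbert space completion of $E\otimes\mathcal{G}$ (modulo null vectors) for $\langle x\otimes g,x'\otimes g'\rangle=\langle g,\langle x,x'\rangle g'\rangle$, and identify $x\in E$ with the operator $L_x\in\mathscr{B}(\mathcal{G},E\odot\mathcal{G})$, $L_xg=x\odot g$. Then $E$ is a von Neumann $\mathcal{B}$-module if it is strongly closed in $\mathscr{B}(\mathcal{G},E\odot\mathcal{G})$. A GNS-representation of a CP map $\phi:\mathcal{A}\to\mathcal{B}$ is a pair $(E,\xi)$ where $E$ is a Hilbert $\mathcal{A}$-$\mathcal{B}$-module and $\xi\in E$ satisfies $\phi(a)=\langle\xi,a\xi\rangle$ for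 all $a\in\mathcal{A}$; it need not be minimal, i.e. $\mathcal{A}\xi\mathcal{B}$ need not have dense span. *)

theory Defs
  imports "HOL-Analysis.Analysis"
begin

section \<open>Complex vector spaces and Hilbert spaces\<close>

class complex_vector = real_vector +
  fixes scaleC :: "complex \<Rightarrow> 'a \<Rightarrow> 'a" (infixr \<open>*\<^sub>C\<close> 75)
  assumes scaleC_add_right: "c *\<^sub>C (x + y) = c *\<^sub>C x + c *\<^sub>C y"
    and scaleC_add_left: "(c + d) *\<^sub>C x = c *\<^sub>C x + d *\<^sub>C x"
    and scaleC_scaleC: "c *\<^sub>C d *\<^sub>C x = (c * d) *\<^sub>C x"
    and scaleC_one: "1 *\<^sub>C x = x"
    and scaleR_scaleC: "r *\<^sub>R x = complex_of_real r *\<^sub>C x"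

global_interpretation complex_vector: vector_space "scaleC :: complex \<Rightarrow> 'a \<Rightarrow> 'a::complex_vector"
  by unfold_locales (simp_all add: scaleC_add_right scaleC_add_left scaleC_scaleC scaleC_one)

definition cspan :: "'a::complex_vector set \<Rightarrow> 'a set"
  where "cspan = module.span scaleC"

definition csubspace :: "'a::complex_vector set \<Rightarrow> bool"
  where "csubspace = module.subspace scaleC"

definition clinear :: "('a::complex_vector \<Rightarrow> 'b::complex_vector) \<Rightarrow> bool"
  where "clinear = Vector_Spaces.linear scaleC scaleC"

class complex_normed_vector = complex_vector + real_normed_vector +
  assumes norm_scaleC: "norm (c *\<^sub>C x) = cmod c * norm x"

class complex_banach = complex_normed_vector + complete_space

subclass (in complex_banach) banach ..

class complex_inner = complex_normed_vector +
  fixes cinner :: "'a \<Rightarrow> 'a \<Rightarrow> complex"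
  assumes cinner_commute: "cinner x y = cnj (cinner y x)"
    and cinner_add_right: "cinner x (y + z) = cinner x y + cinner x z"
    and cinner_scaleC_right: "cinner x (c *\<^sub>C y) = c * cinner x y"
    and cinner_self: "cinner x x = complex_of_real ((norm x)\<^sup>2)"

class chilbert_space = complex_inner + complete_space

subclass (in chilbert_space) complex_banach ..

lemma clinear_iff:
  "clinear f \<longleftrightarrow> (\<forall>x y. f (x + y) = f x + f y) \<and> (\<forall>c x. f (c *\<^sub>C x) = c *\<^sub>C f x)"
  unfolding clinear_def
  by (auto simp: Vector_Spaces.linear_def module_hom_def module_hom_axioms_def
      complex_vector.module_axioms complex_vector.vector_space_axioms)

lemma scaleC_minus_one: "(- 1) *\<^sub>C x = - (x::'a::complex_vector)"
  by (simp add: complex_vector.scale_minus_left scaleC_one)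

lemma cinner_add_left: "cinner (x + y) z = cinner x z + cinner y (z::'a::complex_inner)"
  by (metis cinner_add_right cinner_commute complex_cnj_add)

lemma cinner_scaleC_left: "cinner (c *\<^sub>C x) y = cnj c * cinner x (y::'a::complex_inner)"
  by (metis cinner_commute cinner_scaleC_right complex_cnj_mult)

lemma cinner_scaleR_right: "cinner x (r *\<^sub>R y) = of_real r * cinner x (y::'a::complex_inner)"
  by (simp add: scaleR_scaleC cinner_scaleC_right)

lemma cinner_scaleR_left: "cinner (r *\<^sub>R x) y = of_real r * cinner x (y::'a::complex_inner)"
  by (simp add: scaleR_scaleC cinner_scaleC_left)

lemma cinner_minus_right: "cinner x (- y) = - cinner x (y::'a::complex_inner)"
  by (metis cinner_scaleC_right mult_minus1 scaleC_minus_one)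

lemma cinner_diff_right: "cinner x (y - z) = cinner x y - cinner x (z::'a::complex_inner)"
  by (metis cinner_add_right cinner_minus_right diff_conv_add_uminus)

lemma cinner_diff_left: "cinner (x - y) z = cinner x z - cinner y (z::'a::complex_inner)"
  by (metis cinner_commute cinner_diff_right complex_cnj_diff)

lemma cinner_ext:
  fixes x y :: "'a::complex_inner"
  assumes "\<And>z. cinner x z = cinner y z"
  shows "x = y"
  using assms cinner_self[of "x - y"] by (simp add: cinner_diff_left)

lemma norm_add_sq:
  fixes x y :: "'a::complex_inner"
  shows "(norm (x + y))\<^sup>2 = (norm x)\<^sup>2 + (norm y)\<^sup>2 + 2 * Re (cinner x y)"
proof -
  have "complex_of_real ((norm (x + y))\<^sup>2) = cinner (x + y) (x + y)"
    by (simp only: cinner_self)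
  also have "\<dots> = cinner x x + cinner y y + (cinner x y + cnj (cinner x y))"
    by (simp add: cinner_add_left cinner_add_right cinner_commute[of y x])
  also have "\<dots> = complex_of_real ((norm x)\<^sup>2 + (norm y)\<^sup>2 + 2 * Re (cinner x y))"
    by (simp add: cinner_self complex_add_cnj)
  finally show ?thesis
    by (simp only: of_real_eq_iff)
qed

lemma Re_cinner_le: "Re (cinner x y) \<le> norm x * norm (y::'a::complex_inner)"
proof -
  have "(norm (x + y))\<^sup>2 \<le> (norm x + norm y)\<^sup>2"
    by (simp add: norm_triangle_ineq power_mono)
  then show ?thesis
    by (simp add: norm_add_sq power2_sum)
qed

lemma cinner_Cauchy_Schwarz: "cmod (cinner x y) \<le> norm x * norm (y::'a::complex_inner)"
proof (cases "cinner x y = 0")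
  case False
  define c where "c = cnj (cinner x y) / cmod (cinner x y)"
  have "cmod c = 1"
    using False by (simp add: c_def norm_divide)
  have "cinner x (c *\<^sub>C y) = cmod (cinner x y)"
    using False
    by (simp add: c_def cinner_scaleC_right complex_norm_square[symmetric] field_simps power2_eq_square
        mult.commute[of "cnj _"] del: of_real_power)
  then have "cmod (cinner x y) = Re (cinner x (c *\<^sub>C y))"
    by simp
  also have "\<dots> \<le> norm x * norm y"
    using Re_cinner_le[of x "c *\<^sub>C y"] \<open>cmod c = 1\<close> by (simp add: norm_scaleC)
  finally show ?thesis .
qed simp

lemma Riesz_representation:
  fixes f :: "'a::chilbert_space \<Rightarrow> complex"
  assumes add: "\<And>x y. f (x + y) = f x + f y"
    and scale: "\<And>c x. f (c *\<^sub>C x) = c * f x"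
    and bound: "\<And>x. cmod (f x) \<le> K * norm x"
  shows "\<exists>y. \<forall>x. f x = cinner y x"
proof -
  define J where "J x = (norm x)\<^sup>2 - 2 * Re (f x)" for x
  have Jlow: "- K\<^sup>2 \<le> J x" for x
  proof -
    have "Re (f x) \<le> K * norm x"
      using bound[of x] complex_Re_le_cmod[of "f x"] by linarith
    moreover have "0 \<le> (norm x - K)\<^sup>2"
      by simp
    ultimately show ?thesis
      by (simp add: J_def power2_diff algebra_simps)
  qed
  define m where "m = (INF x. J x)"
  have bdd: "bdd_below (range J)"
    using Jlow by (auto simp: bdd_below_def)
  have mle: "m \<le> J x" for x
    unfolding m_def using bdd by (simp add: cINF_lower)
  have "\<exists>x. J x < m + 1 / real (Suc n)" for n
    using cINF_less_iff[of UNIV J "m + 1 / real (Suc n)"] bdd by (simp add: m_def)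
  then obtain X where X: "\<And>n. J (X n) < m + 1 / real (Suc n)"
    by metis
  have fR: "Re (f (r *\<^sub>R x)) = r * Re (f x)" for r x
    by (simp add: scaleR_scaleC scale)
  have par: "(norm (x - y))\<^sup>2 \<le> 2 * (J x - m) + 2 * (J y - m)" for x y
  proof -
    have "(norm (x - y))\<^sup>2 = (norm x)\<^sup>2 + (norm y)\<^sup>2 - 2 * Re (cinner x y)"
      using norm_add_sq[of x "- y"] by (simp add: cinner_minus_right)
    moreover have "J ((1/2) *\<^sub>R (x + y)) = ((norm x)\<^sup>2 + (norm y)\<^sup>2 + 2 * Re (cinner x y)) / 4
        - (Re (f x) + Re (f y))"
      by (simp only: J_def fR) (simp add: add norm_add_sq cinner_scaleR_left cinner_scaleR_right power_mult_distrib power_divide field_simps)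
    moreover have "J x = (norm x)\<^sup>2 - 2 * Re (f x)" "J y = (norm y)\<^sup>2 - 2 * Re (f y)"
      by (simp_all only: J_def)
    ultimately show ?thesis
      using mle[of "(1/2) *\<^sub>R (x + y)"] by argo
  qed
  have "Cauchy X"
  proof (rule metric_CauchyI)
    fix e :: real assume "0 < e"
    then obtain N where N: "4 * (1 / real (Suc N)) < e\<^sup>2"
      using reals_Archimedean[of "e\<^sup>2 / 4"] by (auto simp: field_simps)
    have "dist (X p) (X q) < e" if "p \<ge> N" "q \<ge> N" for p q
    proof -
      have "1 / real (Suc p) \<le> 1 / real (Suc N)" "1 / real (Suc q) \<le> 1 / real (Suc N)"
        using that by (simp_all add: frac_le)
      then have "(norm (X p - X q))\<^sup>2 < e\<^sup>2"
        using par[of "X p" "X q"] X[of p] X[of q] N by argo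
      then show ?thesis
        using \<open>0 < e\<close> by (simp add: dist_norm power_less_imp_less_base)
    qed
    then show "\<exists>M. \<forall>m\<ge>M. \<forall>n\<ge>M. dist (X m) (X n) < e"
      by blast
  qed
  then obtain y where y: "X \<longlonglongrightarrow> y"
    using Cauchy_convergent convergent_def by blast
  have f0: "f (a - b) = f a - f b" for a b
    using add[of "a - b" b] by simp
  have flim: "(\<lambda>n. f (X n)) \<longlonglongrightarrow> f y"
  proof (rule Lim_null_comparison[THEN LIM_zero_cancel])
    show "\<forall>\<^sub>F n in sequentially. norm (f (X n) - f y) \<le> K * norm (X n - y)"
      by (simp add: f0[symmetric] bound)
    show "(\<lambda>n. K * norm (X n - y)) \<longlonglongrightarrow> 0"
      using y by (intro tendsto_mult_right_zero tendsto_norm_zero LIM_zero)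
  qed
  have "(\<lambda>n. J (X n)) \<longlonglongrightarrow> J y"
    unfolding J_def by (intro tendsto_intros y flim)
  moreover have "(\<lambda>n. m + 1 / real (Suc n)) \<longlonglongrightarrow> m + 0"
    by (intro tendsto_add tendsto_const LIMSEQ_Suc[OF lim_1_over_n])
  ultimately have Jy: "J y \<le> m"
    using X by (metis (mono_tags, lifting) LIMSEQ_le add.right_neutral less_imp_le)
  have Re_eq: "Re (f h) = Re (cinner y h)" for h
  proof (rule ccontr)
    assume neq: "Re (f h) \<noteq> Re (cinner y h)"
    define d where "d = Re (f h) - Re (cinner y h)"
    define t where "t = d / ((norm h)\<^sup>2 + 1)"
    have pos: "(norm h)\<^sup>2 + 1 > 0"
      by (simp add: add_nonneg_pos)
    have "J y \<le> J (y + t *\<^sub>R h)"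
      using Jy mle order_trans by blast
    then have "0 \<le> t\<^sup>2 * (norm h)\<^sup>2 - 2 * t * d"
      by (simp add: J_def norm_add_sq cinner_scaleR_right add fR d_def power_mult_distrib algebra_simps)
    also have "\<dots> \<le> t\<^sup>2 * ((norm h)\<^sup>2 + 1) - 2 * t * d"
      by (simp add: algebra_simps)
    also have "t\<^sup>2 * ((norm h)\<^sup>2 + 1) = t * d"
      using pos by (simp add: t_def power2_eq_square)
    finally have "t * d \<le> 0"
      by (simp add: mult.commute)
    moreover have "t * d = d\<^sup>2 / ((norm h)\<^sup>2 + 1)"
      by (simp add: t_def power2_eq_square)
    moreover have "d\<^sup>2 > 0"
      using neq by (simp add: d_def)
    ultimately show False
      using pos by (simp add: divide_le_0_iff)
  qed
  have "f h = cinner y h" for h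
  proof (rule complex_eqI)
    show "Im (f h) = Im (cinner y h)"
      using Re_eq[of "\<i> *\<^sub>C h"] by (simp add: scale cinner_scaleC_right)
  qed (rule Re_eq)
  then show ?thesis
    by blast
qed


section \<open>Unital C*-algebras\<close>

class star =
  fixes star :: "'a \<Rightarrow> 'a"

class complex_star_algebra = complex_vector + ring + star +
  assumes mult_scaleC_left: "(c *\<^sub>C x) * y = c *\<^sub>C (x * y)"
    and mult_scaleC_right: "x * (c *\<^sub>C y) = c *\<^sub>C (x * y)"
    and star_star: "star (star x) = x"
    and star_add: "star (x + y) = star x + star y"
    and star_mult: "star (x * y) = star y * star x"
    and star_scaleC: "star (c *\<^sub>C x) = cnj c *\<^sub>C star x"

text \<open>\<^class>\<open>monoid_mult\<close> rather than \<^class>\<open>ring_1\<close>, so that the zero algebra is not excluded.\<close>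

class unital_cstar_algebra =
  complex_star_algebra + complex_normed_vector + real_normed_algebra + monoid_mult + complete_space +
  assumes cstar_identity: "norm (star x * x) = (norm x)\<^sup>2"

subclass (in unital_cstar_algebra) complex_banach ..


section \<open>The C*-algebra of bounded operators on a Hilbert space\<close>

typedef (overloaded) 'g bop =
  "{T :: 'g::complex_normed_vector \<Rightarrow>\<^sub>L 'g. clinear (blinfun_apply T)}"
  morphisms blinfun_of_bop Bop
  by (rule exI[of _ id_blinfun]) (simp add: clinear_iff)

setup_lifting type_definition_bop

lift_definition bop_apply :: "'g::complex_normed_vector bop \<Rightarrow> 'g \<Rightarrow> 'g" is blinfun_apply .

lemma bop_eqI: "(\<And>x. bop_apply S x = bop_apply T x) \<Longrightarrow> S = T"
  by transfer (rule blinfun_eqI)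

lemma bop_apply_add: "bop_apply T (x + y) = bop_apply T x + bop_apply T y"
  by transfer (simp add: clinear_iff)

lemma bop_apply_scaleC: "bop_apply T (c *\<^sub>C x) = c *\<^sub>C bop_apply T x"
  by transfer (simp add: clinear_iff)

lemma bounded_linear_scaleC: "bounded_linear (\<lambda>x::'a::complex_normed_vector. c *\<^sub>C x)"
  by (rule bounded_linear_intro[where K = "cmod c"])
    (simp_all add: scaleC_add_right scaleR_scaleC scaleC_scaleC norm_scaleC mult.commute)

instantiation bop :: (complex_normed_vector) "{complex_normed_vector, real_normed_algebra, monoid_mult}"
begin

lift_definition zero_bop :: "'a bop" is 0
  by (simp add: clinear_iff)

lift_definition one_bop :: "'a bop" is id_blinfun
  by (simp add: clinear_iff)

lift_definition plus_bop :: "'a bop \<Rightarrow> 'a bop \<Rightarrow> 'a bop" is "(+)"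
  by (simp add: clinear_iff blinfun.bilinear_simps scaleC_add_right)

lift_definition minus_bop :: "'a bop \<Rightarrow> 'a bop \<Rightarrow> 'a bop" is "(-)"
  by (simp add: clinear_iff blinfun.bilinear_simps complex_vector.scale_right_diff_distrib)

lift_definition uminus_bop :: "'a bop \<Rightarrow> 'a bop" is uminus
  by (simp add: clinear_iff blinfun.bilinear_simps complex_vector.scale_minus_right)

lift_definition times_bop :: "'a bop \<Rightarrow> 'a bop \<Rightarrow> 'a bop" is "(o\<^sub>L)"
  by (simp add: clinear_iff)

lift_definition scaleR_bop :: "real \<Rightarrow> 'a bop \<Rightarrow> 'a bop" is scaleR
  by (simp add: clinear_iff blinfun.bilinear_simps scaleR_scaleC scaleC_scaleC scaleC_add_right
      mult.commute)

lift_definition scaleC_bop :: "complex \<Rightarrow> 'a bop \<Rightarrow> 'a bop"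
  is "\<lambda>c T. Blinfun (\<lambda>x. c *\<^sub>C blinfun_apply T x)"
  by (subst bounded_linear_Blinfun_apply[OF bounded_linear_compose[OF bounded_linear_scaleC blinfun.bounded_linear_right]])
    (simp add: clinear_iff scaleC_add_right scaleC_scaleC mult.commute)

lift_definition norm_bop :: "'a bop \<Rightarrow> real" is norm .

definition dist_bop :: "'a bop \<Rightarrow> 'a bop \<Rightarrow> real"
  where "dist_bop S T = norm (S - T)"

definition sgn_bop :: "'a bop \<Rightarrow> 'a bop"
  where "sgn_bop T = inverse (norm T) *\<^sub>R T"

definition uniformity_bop :: "('a bop \<times> 'a bop) filter"
  where "uniformity_bop = (INF e\<in>{0<..}. principal {(x, y). dist x y < e})"

definition open_bop :: "'a bop set \<Rightarrow> bool"
  where "open_bop U = (\<forall>x\<in>U. \<forall>\<^sub>F (x', y) in uniformity. x' = x \<longrightarrow> y \<in> U)"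

lemma scaleC_bop_apply: "bop_apply (c *\<^sub>C T) x = c *\<^sub>C bop_apply T x"
  by transfer (simp add: bounded_linear_Blinfun_apply[OF bounded_linear_compose[OF bounded_linear_scaleC blinfun.bounded_linear_right]])

instance
proof
  fix S T U :: "'a bop" and a b :: real and c d :: complex
  show "S + T + U = S + (T + U)" "S + T = T + S" "0 + S = S" "- S + S = 0" "S - T = S + - T"
    by (transfer; simp)+
  show "a *\<^sub>R (S + T) = a *\<^sub>R S + a *\<^sub>R T" "(a + b) *\<^sub>R S = a *\<^sub>R S + b *\<^sub>R S"
    "a *\<^sub>R b *\<^sub>R S = (a * b) *\<^sub>R S" "1 *\<^sub>R S = S"
    by (transfer; simp add: scaleR_add_right scaleR_add_left)+
  have add: "bop_apply (S + T) x = bop_apply S x + bop_apply T x" for S T :: "'a bop" and x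
    by transfer (simp add: blinfun.bilinear_simps)
  have scR: "bop_apply (a *\<^sub>R S) x = a *\<^sub>R bop_apply S x" for x
    by transfer (simp add: blinfun.bilinear_simps)
  show "c *\<^sub>C (S + T) = c *\<^sub>C S + c *\<^sub>C T" "(c + d) *\<^sub>C S = c *\<^sub>C S + d *\<^sub>C S"
    "c *\<^sub>C d *\<^sub>C S = (c * d) *\<^sub>C S" "1 *\<^sub>C S = S" "a *\<^sub>R S = complex_of_real a *\<^sub>C S"
    by (rule bop_eqI, simp add: scaleC_bop_apply add scR scaleC_add_right scaleC_add_left scaleC_scaleC
        scaleC_one scaleR_scaleC)+
  show "S * T * U = S * (T * U)" "1 * S = S" "S * 1 = S"
    by (transfer, rule blinfun_eqI, simp)+
  show "(S + T) * U = S * U + T * U" "S * (T + U) = S * T + S * U"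
    "(a *\<^sub>R S) * T = a *\<^sub>R (S * T)" "S * (a *\<^sub>R T) = a *\<^sub>R (S * T)"
    by (transfer, rule blinfun_eqI, simp add: blinfun.bilinear_simps)+
  show "sgn S = inverse (norm S) *\<^sub>R S" "dist S T = norm (S - T)"
    by (simp_all add: sgn_bop_def dist_bop_def)
  show "norm S = 0 \<longleftrightarrow> S = 0" "norm (S + T) \<le> norm S + norm T" "norm (a *\<^sub>R S) = \<bar>a\<bar> * norm S"
    "norm (S * T) \<le> norm S * norm T"
    by (transfer; simp add: norm_triangle_ineq norm_blinfun_compose)+
  show "norm (c *\<^sub>C S) = cmod c * norm S"
  proof -
    have nonneg: "0 \<le> norm S" for S :: "'a bop"
      by transfer simp
    have le: "norm (c *\<^sub>C S) \<le> cmod c * norm S" for c and S :: "'a bop"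
    proof transfer
      fix c and S :: "'a \<Rightarrow>\<^sub>L 'a"
      show "norm (Blinfun (\<lambda>x. c *\<^sub>C blinfun_apply S x)) \<le> cmod c * norm S"
        by (rule norm_blinfun_bound)
          (simp_all add: norm_scaleC mult.assoc mult_left_mono norm_blinfun
            bounded_linear_Blinfun_apply[OF bounded_linear_compose[OF bounded_linear_scaleC blinfun.bounded_linear_right]])
    qed
    show ?thesis
    proof (cases "c = 0")
      case True
      then show ?thesis
        using le[of 0 S] nonneg[of "0 *\<^sub>C S"] by simp
    next
      case False
      then have "inverse c *\<^sub>C c *\<^sub>C S = S"
        by (intro bop_eqI) (simp add: scaleC_bop_apply scaleC_scaleC scaleC_one)
      then have "norm S \<le> cmod (inverse c) * norm (c *\<^sub>C S)"
        using le[of "inverse c" "c *\<^sub>C S"] by simp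
      with False have "cmod c * norm S \<le> norm (c *\<^sub>C S)"
        by (simp add: norm_inverse norm_divide field_simps)
      with le[of c S] show ?thesis
        by simp
    qed
  qed
qed (simp_all add: uniformity_bop_def open_bop_def)

end

lemma bop_apply_plus: "bop_apply (S + T) x = bop_apply S x + bop_apply T x"
  by transfer (simp add: blinfun.bilinear_simps)

lemma bop_apply_times: "bop_apply (S * T) x = bop_apply S (bop_apply T x)"
  by transfer simp

lemma norm_bop_apply: "norm (bop_apply T x) \<le> norm T * norm x"
  by transfer (rule norm_blinfun)

instantiation bop :: (chilbert_space) star
begin

definition star_bop :: "'a bop \<Rightarrow> 'a bop"
  where "star T = (THE S. \<forall>x y. cinner (bop_apply S x) y = cinner x (bop_apply T y))"

instance ..

end

lemma bop_adjoint_exists: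
  fixes T :: "'g::chilbert_space bop"
  shows "\<exists>S. (\<forall>x y. cinner (bop_apply S x) y = cinner x (bop_apply T y)) \<and> norm S \<le> norm T"
proof -
  have "\<exists>z. \<forall>y. cinner x (bop_apply T y) = cinner z y" for x
  proof (rule Riesz_representation)
    show "cmod (cinner x (bop_apply T y)) \<le> (norm x * norm T) * norm y" for y
      using cinner_Cauchy_Schwarz[of x "bop_apply T y"]
        mult_left_mono[OF norm_bop_apply[of T y], of "norm x"]
      by (simp add: mult.assoc)
  qed (simp_all add: bop_apply_add bop_apply_scaleC cinner_add_right cinner_scaleC_right)
  then obtain S where S: "\<And>x y. cinner (S x) y = cinner x (bop_apply T y)"
    by metis
  have Sadd: "S (x + y) = S x + S y" for x y
    by (rule cinner_ext) (simp add: S cinner_add_left)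
  have Sscale: "S (c *\<^sub>C x) = c *\<^sub>C S x" for c x
    by (rule cinner_ext) (simp add: S cinner_scaleC_left)
  have Snorm: "norm (S x) \<le> norm T * norm x" for x
  proof (cases "S x = 0")
    case False
    have "complex_of_real ((norm (S x))\<^sup>2) = cinner x (bop_apply T (S x))"
      by (metis S cinner_self)
    then have "(norm (S x))\<^sup>2 = cmod (cinner x (bop_apply T (S x)))"
      by (metis norm_of_real abs_of_nonneg zero_le_power2)
    also have "\<dots> \<le> norm x * norm (bop_apply T (S x))"
      by (rule cinner_Cauchy_Schwarz)
    also have "\<dots> \<le> norm x * (norm T * norm (S x))"
      by (intro mult_left_mono norm_bop_apply) simp
    finally have "norm (S x) * norm (S x) \<le> (norm T * norm x) * norm (S x)"
      by (simp add: power2_eq_square mult_ac)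
    with False show ?thesis
      by simp
  qed (simp add: norm_bop_apply)
  have bl: "bounded_linear S"
    using Snorm by (intro bounded_linear_intro[where K = "norm T"])
      (simp_all add: Sadd Sscale scaleR_scaleC mult.commute)
  define S' where "S' = Bop (Blinfun S)"
  have mem: "Blinfun S \<in> {T. clinear (blinfun_apply T)}"
    by (simp add: bounded_linear_Blinfun_apply[OF bl] clinear_iff Sadd Sscale)
  have ap: "bop_apply S' x = S x" for x
    by (simp add: S'_def bop_apply.rep_eq Bop_inverse[OF mem] bounded_linear_Blinfun_apply[OF bl])
  have "norm S' \<le> norm T"
    unfolding norm_bop.rep_eq S'_def Bop_inverse[OF mem]
    by (rule norm_blinfun_bound)
      (simp_all add: bounded_linear_Blinfun_apply[OF bl] Snorm flip: norm_bop.rep_eq)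
  with S ap show ?thesis
    by (intro exI[of _ S']) simp
qed

lemma star_bop_unique:
  fixes S T :: "'g::chilbert_space bop"
  assumes "\<And>x y. cinner (bop_apply S x) y = cinner x (bop_apply T y)"
  shows "star T = S"
  unfolding star_bop_def
proof (rule the_equality)
  show "R = S" if "\<forall>x y. cinner (bop_apply R x) y = cinner x (bop_apply T y)" for R
    using that assms by (intro bop_eqI cinner_ext) simp
qed (use assms in blast)

lemma cinner_star_bop: "cinner (bop_apply (star T) x) y = cinner x (bop_apply T y)"
  using bop_adjoint_exists[of T] star_bop_unique[of _ T] by metis

lemma norm_star_bop_le: "norm (star T) \<le> norm (T :: 'g::chilbert_space bop)"
  using bop_adjoint_exists[of T] star_bop_unique[of _ T] by metis

lemma bop_complete:
  fixes X :: "nat \<Rightarrow> 'g::chilbert_space bop"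
  assumes "Cauchy X"
  shows "convergent X"
proof -
  have nd: "dist (blinfun_of_bop S) (blinfun_of_bop T) = dist S T" for S T :: "'g bop"
    by (simp add: dist_norm norm_bop.rep_eq minus_bop.rep_eq)
  have "Cauchy (\<lambda>n. blinfun_of_bop (X n))"
    using assms by (simp add: Cauchy_def nd)
  have pt: "Cauchy (\<lambda>n. bop_apply (X n) x)" for x
    using bounded_linear.Cauchy[OF blinfun.bounded_linear_left \<open>Cauchy (\<lambda>n. blinfun_of_bop (X n))\<close>, of x]
    by (simp add: bop_apply.rep_eq)
  obtain L where L: "(\<lambda>n. blinfun_of_bop (X n)) \<longlonglongrightarrow> L"
    using \<open>Cauchy (\<lambda>n. blinfun_of_bop (X n))\<close> Cauchy_convergent convergent_def by blast
  have lim: "(\<lambda>n. bop_apply (X n) x) \<longlonglongrightarrow> blinfun_apply L x" for x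
    using bounded_linear.tendsto[OF blinfun.bounded_linear_left L, of x] by (simp add: bop_apply.rep_eq)
  have "blinfun_apply L (c *\<^sub>C x) = c *\<^sub>C blinfun_apply L x" for c x
    using LIMSEQ_unique[OF lim[of "c *\<^sub>C x"]] bounded_linear.tendsto[OF bounded_linear_scaleC lim]
    by (simp add: bop_apply_scaleC)
  then have mem: "L \<in> {T. clinear (blinfun_apply T)}"
    by (simp add: clinear_iff blinfun.bilinear_simps)
  have "X \<longlonglongrightarrow> Bop L"
    using L by (simp add: tendsto_iff nd[symmetric] Bop_inverse[OF mem])
  then show ?thesis
    by (auto simp: convergent_def)
qed

instance bop :: (chilbert_space) unital_cstar_algebra
proof
  fix S T :: "'a bop" and c :: complex and X :: "nat \<Rightarrow> 'a bop"
  show "(c *\<^sub>C S) * T = c *\<^sub>C (S * T)" "S * (c *\<^sub>C T) = c *\<^sub>C (S * T)"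
    by (rule bop_eqI, simp add: bop_apply_times scaleC_bop_apply bop_apply_scaleC)+
  have ss: "star (star T) = T" for T :: "'a bop"
    by (rule star_bop_unique) (metis cinner_commute cinner_star_bop)
  then show "star (star S) = S" .
  show "star (S + T) = star S + star T"
    by (rule star_bop_unique) (simp add: bop_apply_plus cinner_add_left cinner_add_right cinner_star_bop)
  show "star (S * T) = star T * star S"
    by (rule star_bop_unique) (simp add: bop_apply_times cinner_star_bop)
  show "star (c *\<^sub>C S) = cnj c *\<^sub>C star S"
    by (rule star_bop_unique)
      (simp add: scaleC_bop_apply cinner_scaleC_left cinner_scaleC_right cinner_star_bop)
  have ns: "norm (star T) = norm T" for T :: "'a bop"
    using norm_star_bop_le[of T] norm_star_bop_le[of "star T"] by (simp add: ss)
  have "(norm S)\<^sup>2 \<le> norm (star S * S)"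
  proof -
    have "norm (bop_apply S x) \<le> sqrt (norm (star S * S)) * norm x" for x
    proof -
      have "complex_of_real ((norm (bop_apply S x))\<^sup>2) = cinner x (bop_apply (star S * S) x)"
        by (metis bop_apply_times cinner_commute cinner_self cinner_star_bop complex_cnj_complex_of_real)
      then have "(norm (bop_apply S x))\<^sup>2 = cmod (cinner x (bop_apply (star S * S) x))"
        by (metis norm_of_real abs_of_nonneg zero_le_power2)
      also have "\<dots> \<le> norm x * norm (bop_apply (star S * S) x)"
        by (rule cinner_Cauchy_Schwarz)
      also have "\<dots> \<le> norm x * (norm (star S * S) * norm x)"
        by (intro mult_left_mono norm_bop_apply) simp
      also have "\<dots> = (sqrt (norm (star S * S)) * norm x)\<^sup>2"
        by (simp add: power_mult_distrib power2_eq_square)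
      finally show ?thesis
        by (rule power2_le_imp_le) simp
    qed
    then have "norm S \<le> sqrt (norm (star S * S))"
      by (simp add: norm_bop.rep_eq[of S] norm_blinfun_bound bop_apply.rep_eq)
    then have "(norm S)\<^sup>2 \<le> (sqrt (norm (star S * S)))\<^sup>2"
      by (rule power_mono) simp
    then show ?thesis
      by simp
  qed
  moreover have "norm (star S * S) \<le> (norm S)\<^sup>2"
    using norm_mult_ineq[of "star S" S] by (simp add: ns power2_eq_square)
  ultimately show "norm (star S * S) = (norm S)\<^sup>2"
    by simp
  show "convergent X" if "Cauchy X"
    using that by (rule bop_complete)
qed

definition von_neumann_algebra :: "'g::chilbert_space bop set \<Rightarrow> bool"
  where "von_neumann_algebra B \<longleftrightarrow>
    csubspace B \<and> 1 \<in> B \<and> (\<forall>S\<in>B. \<forall>T\<in>B. S * T \<in> B) \<and> (\<forall>T\<in>B. star T \<in> B) \<and>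
    closedin strong_operator_topology (blinfun_of_bop ` B)"


section \<open>Two by two matrices\<close>

datatype 'a mat2 = Mat2 (m11: 'a) (m12: 'a) (m21: 'a) (m22: 'a)

instantiation mat2 :: (zero) zero
begin
definition "0 = Mat2 0 0 0 0"
instance ..
end

instantiation mat2 :: (plus) plus
begin
definition "X + Y = Mat2 (m11 X + m11 Y) (m12 X + m12 Y) (m21 X + m21 Y) (m22 X + m22 Y)"
instance ..
end

instantiation mat2 :: (minus) minus
begin
definition "X - Y = Mat2 (m11 X - m11 Y) (m12 X - m12 Y) (m21 X - m21 Y) (m22 X - m22 Y)"
instance ..
end

instantiation mat2 :: (uminus) uminus
begin
definition "- X = Mat2 (- m11 X) (- m12 X) (- m21 X) (- m22 X)"
instance ..
end

instantiation mat2 :: ("{plus,times}") times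
begin
definition "X * Y = Mat2
  (m11 X * m11 Y + m12 X * m21 Y) (m11 X * m12 Y + m12 X * m22 Y)
  (m21 X * m11 Y + m22 X * m21 Y) (m21 X * m12 Y + m22 X * m22 Y)"
instance ..
end

instantiation mat2 :: (scaleR) scaleR
begin
definition "r *\<^sub>R X = Mat2 (r *\<^sub>R m11 X) (r *\<^sub>R m12 X) (r *\<^sub>R m21 X) (r *\<^sub>R m22 X)"
instance ..
end

instantiation mat2 :: (star) star
begin
definition "star X = Mat2 (star (m11 X)) (star (m21 X)) (star (m12 X)) (star (m22 X))"
instance ..
end

lemmas mat2_defs = zero_mat2_def plus_mat2_def minus_mat2_def uminus_mat2_def times_mat2_def
  scaleR_mat2_def star_mat2_def

instance mat2 :: (ab_group_add) ab_group_add
  by standard (simp_all add: mat2_defs mat2.expand)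

instance mat2 :: (ring) ring
  by standard (simp_all add: mat2_defs algebra_simps)

instance mat2 :: (real_vector) real_vector
  by standard (simp_all add: mat2_defs algebra_simps)

instantiation mat2 :: (complex_vector) complex_vector
begin
definition "c *\<^sub>C X = Mat2 (c *\<^sub>C m11 X) (c *\<^sub>C m12 X) (c *\<^sub>C m21 X) (c *\<^sub>C m22 X)"
instance
  by standard (simp_all add: mat2_defs scaleC_mat2_def scaleC_add_right scaleC_add_left scaleC_scaleC
      scaleC_one scaleR_scaleC)
end

instance mat2 :: (complex_star_algebra) complex_star_algebra
  by standard (simp_all add: mat2_defs scaleC_mat2_def scaleC_add_right mult_scaleC_left mult_scaleC_right
      star_star star_add star_mult star_scaleC add.commute)

definition mat2_over :: "'a set \<Rightarrow> 'a mat2 set"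
  where "mat2_over B = {X. m11 X \<in> B \<and> m12 X \<in> B \<and> m21 X \<in> B \<and> m22 X \<in> B}"


section \<open>Completely positive and completely bounded maps\<close>

text \<open>An \<open>n \<times> n\<close> matrix over an algebra is a function on indices, of which only the
  values at indices below \<open>n\<close> matter. Positivity in the C*-algebra \<open>M\<^sub>n(B)\<close> means being of
  the form \<open>Y\<^sup>*Y\<close> with \<open>Y \<in> M\<^sub>n(B)\<close>.\<close>

definition mat_positive :: "'a::complex_star_algebra set \<Rightarrow> nat \<Rightarrow> (nat \<Rightarrow> nat \<Rightarrow> 'a) \<Rightarrow> bool"
  where "mat_positive B n X \<longleftrightarrow>
    (\<exists>Y. (\<forall>i<n. \<forall>j<n. Y i j \<in> B) \<and> (\<forall>i<n. \<forall>j<n. X i j = (\<Sum>k<n. star (Y k i) * Y k j)))"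

definition completely_positive ::
    "'b set \<Rightarrow> ('a::complex_star_algebra \<Rightarrow> 'b::complex_star_algebra) \<Rightarrow> bool"
  where "completely_positive B \<phi> \<longleftrightarrow> clinear \<phi> \<and> range \<phi> \<subseteq> B \<and>
    (\<forall>n X. mat_positive UNIV n X \<longrightarrow> mat_positive B n (\<lambda>i j. \<phi> (X i j)))"

text \<open>The C*-norm of \<open>M\<^sub>n(A)\<close> is the operator norm of its action on the Hilbert \<open>A\<close>-module
  \<open>A\<^sup>n\<close>, whose norm is \<open>col_norm\<close>.\<close>

definition col_norm :: "nat \<Rightarrow> (nat \<Rightarrow> 'a::unital_cstar_algebra) \<Rightarrow> real"
  where "col_norm n v = sqrt (norm (\<Sum>i<n. star (v i) * v i))"

definition mat_norm :: "nat \<Rightarrow> (nat \<Rightarrow> nat \<Rightarrow> 'a::unital_cstar_algebra) \<Rightarrow> real"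
  where "mat_norm n X = (SUP v\<in>{v. col_norm n v \<le> 1}. col_norm n (\<lambda>i. \<Sum>j<n. X i j * v j))"

definition completely_bounded ::
    "'b set \<Rightarrow> ('a::unital_cstar_algebra \<Rightarrow> 'b::unital_cstar_algebra) \<Rightarrow> bool"
  where "completely_bounded B \<psi> \<longleftrightarrow> clinear \<psi> \<and> range \<psi> \<subseteq> B \<and>
    (\<exists>K. \<forall>n X. mat_norm n (\<lambda>i j. \<psi> (X i j)) \<le> K * mat_norm n X)"

definition star_map :: "('a::star \<Rightarrow> 'b::star) \<Rightarrow> 'a \<Rightarrow> 'b"
  where "star_map \<psi> a = star (\<psi> (star a))"

definition block_map ::
    "('a::star \<Rightarrow> 'b::star) \<Rightarrow> ('a \<Rightarrow> 'b) \<Rightarrow> ('a \<Rightarrow> 'b) \<Rightarrow> 'a mat2 \<Rightarrow> 'b mat2"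
  where "block_map \<phi>\<^sub>1 \<psi> \<phi>\<^sub>2 X =
    Mat2 (\<phi>\<^sub>1 (m11 X)) (\<psi> (m12 X)) (star_map \<psi> (m21 X)) (\<phi>\<^sub>2 (m22 X))"


section \<open>Hilbert modules\<close>

text \<open>The right action \<open>ract\<close> is only meaningful on \<open>B\<close>. Completeness of the module is the class
  \<^class>\<open>complex_banach\<close> together with \<open>norm_eq\<close>, which also makes the inner product definite.\<close>

locale hilbert_module =
  fixes B :: "'g::chilbert_space bop set"
    and ip :: "'e::complex_banach \<Rightarrow> 'e \<Rightarrow> 'g bop"
    and ract :: "'e \<Rightarrow> 'g bop \<Rightarrow> 'e"
  assumes ract_clinear: "b \<in> B \<Longrightarrow> clinear (\<lambda>x. ract x b)"
    and ract_add: "b \<in> B \<Longrightarrow> b' \<in> B \<Longrightarrow> ract x (b + b') = ract x b + ract x b'"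
    and ract_scaleC: "b \<in> B \<Longrightarrow> ract x (c *\<^sub>C b) = c *\<^sub>C ract x b"
    and ract_mult: "b \<in> B \<Longrightarrow> b' \<in> B \<Longrightarrow> ract x (b * b') = ract (ract x b) b'"
    and ract_one: "ract x 1 = x"
    and ip_in: "ip x y \<in> B"
    and ip_clinear: "clinear (ip x)"
    and ip_ract: "b \<in> B \<Longrightarrow> ip x (ract y b) = ip x y * b"
    and ip_star: "star (ip x y) = ip y x"
    and ip_positive: "\<exists>b\<in>B. ip x x = star b * b"
    and norm_eq: "norm x = sqrt (norm (ip x x))"

definition adjointable ::
    "('e \<Rightarrow> 'e \<Rightarrow> 'g bop) \<Rightarrow> ('f \<Rightarrow> 'f \<Rightarrow> 'g bop) \<Rightarrow> ('e \<Rightarrow> 'f) \<Rightarrow> bool"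
  where "adjointable ip\<^sub>E ip\<^sub>F T \<longleftrightarrow> (\<exists>S. \<forall>x y. ip\<^sub>F (T x) y = ip\<^sub>E x (S y))"

text \<open>\<open>lact_star\<close> says that \<open>lact a\<close> is adjointable and that its adjoint is \<open>lact (star a)\<close>.\<close>

locale hilbert_bimodule = hilbert_module B ip ract
  for B :: "'g::chilbert_space bop set"
    and ip :: "'e::complex_banach \<Rightarrow> 'e \<Rightarrow> 'g bop"
    and ract :: "'e \<Rightarrow> 'g bop \<Rightarrow> 'e" +
  fixes lact :: "'a::unital_cstar_algebra \<Rightarrow> 'e \<Rightarrow> 'e"
  assumes lact_clinear: "clinear (\<lambda>a. lact a x)"
    and lact_mult: "lact (a * a') x = lact a (lact a' x)"
    and lact_star: "ip (lact a x) y = ip x (lact (star a) y)"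
    and lact_nondegenerate: "closure (cspan {lact a x | a x. True}) = UNIV"

definition bilinear_map ::
    "'g::chilbert_space bop set \<Rightarrow> ('e \<Rightarrow> 'g bop \<Rightarrow> 'e) \<Rightarrow> ('a \<Rightarrow> 'e \<Rightarrow> 'e)
      \<Rightarrow> ('f \<Rightarrow> 'g bop \<Rightarrow> 'f) \<Rightarrow> ('a \<Rightarrow> 'f \<Rightarrow> 'f)
      \<Rightarrow> ('e::complex_vector \<Rightarrow> 'f::complex_vector) \<Rightarrow> bool"
  where "bilinear_map B ract\<^sub>E lact\<^sub>E ract\<^sub>F lact\<^sub>F T \<longleftrightarrow> clinear T \<and>
    (\<forall>a x. T (lact\<^sub>E a x) = lact\<^sub>F a (T x)) \<and> (\<forall>b\<in>B. \<forall>x. T (ract\<^sub>E x b) = ract\<^sub>F (T x) b)"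

definition gns_representation ::
    "'g::chilbert_space bop set \<Rightarrow> ('e::complex_banach \<Rightarrow> 'e \<Rightarrow> 'g bop) \<Rightarrow> ('e \<Rightarrow> 'g bop \<Rightarrow> 'e)
      \<Rightarrow> ('a::unital_cstar_algebra \<Rightarrow> 'e \<Rightarrow> 'e) \<Rightarrow> 'e \<Rightarrow> ('a \<Rightarrow> 'g bop) \<Rightarrow> bool"
  where "gns_representation B ip ract lact \<xi> \<phi> \<longleftrightarrow>
    hilbert_bimodule B ip ract lact \<and> (\<forall>a. \<phi> a = ip \<xi> (lact a \<xi>))"

text \<open>\<open>interior_tensor ip tens\<close> says that the Hilbert space \<open>'h\<close>, with \<open>tens x g\<close> as
  \<open>x \<odot> g\<close>, is the completion of \<open>E \<otimes> \<G>\<close> modulo null vectors. This determines the pair up to a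
  unique unitary. The inner product formula forces \<open>tens\<close> to be bilinear, because the kernel on the
  right-hand side is sesquilinear.\<close>

definition interior_tensor ::
    "('e \<Rightarrow> 'e \<Rightarrow> 'g::chilbert_space bop) \<Rightarrow> ('e \<Rightarrow> 'g \<Rightarrow> 'h::chilbert_space) \<Rightarrow> bool"
  where "interior_tensor ip tens \<longleftrightarrow>
    (\<forall>x g x' g'. cinner (tens x g) (tens x' g') = cinner g (bop_apply (ip x x') g')) \<and>
    closure (cspan {tens x g | x g. True}) = UNIV"

text \<open>\<open>Blinfun (tens x)\<close> is the operator \<open>L\<^sub>x\<close>. The complex-linear operators are closed in the strong
  topology of \<^typ>\<open>'g \<Rightarrow>\<^sub>L 'h\<close>, so closedness relative to them is closedness in \<^typ>\<open>'g \<Rightarrow>\<^sub>L 'h\<close>;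
  the same applies in \<^const>\<open>von_neumann_algebra\<close>.\<close>

definition von_neumann_module ::
    "'g::chilbert_space bop set \<Rightarrow> ('e::complex_banach \<Rightarrow> 'e \<Rightarrow> 'g bop) \<Rightarrow> ('e \<Rightarrow> 'g bop \<Rightarrow> 'e)
      \<Rightarrow> ('e \<Rightarrow> 'g \<Rightarrow> 'h::chilbert_space) \<Rightarrow> bool"
  where "von_neumann_module B ip ract tens \<longleftrightarrow>
    hilbert_module B ip ract \<and> interior_tensor ip tens \<and>
    closedin strong_operator_topology (range (\<lambda>x. Blinfun (tens x)))"

end

theory Submission
  imports Defs
begin

text \<open>
The contraction \<open>T\<close> is found as an operator between Hilbert spaces and then shown to come from the
modules. Write \<open>H\<^sub>i = F\<^sub>i \<odot> \<G>\<close>, \<open>X\<^sub>i = {a y\<^sub>i | a \<in> \<A>}\<close>, and \<open>K\<^sub>i \<subseteq> H\<^sub>i\<close> for the closed span of \<open>X\<^sub>i \<odot> \<G>\<close>.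

Complete positivity of the block map says that the form with diagonal parts \<open>\<langle>g, \<phi>\<^sub>i(a\<^sup>* a') g'\<rangle>\<close> and
off-diagonal part \<open>\<langle>g, \<psi>(a\<^sup>* a') g'\<rangle>\<close> is positive. The diagonal parts are inner products of the vectors
\<open>a y\<^sub>i \<odot> g\<close>, so Cauchy-Schwarz bounds the off-diagonal part by the norms in \<open>K\<^sub>1\<close> and \<open>K\<^sub>2\<close>
(\<open>completely_positive_block_kernel_bound\<close>). Hence there is a contraction \<open>V : H\<^sub>2 \<rightarrow> H\<^sub>1\<close>, with range in \<open>K\<^sub>1\<close>
and adjoint \<open>Q\<close> with range in \<open>K\<^sub>2\<close>, such that
\<open>\<langle>a y\<^sub>1 \<odot> g, V (a' y\<^sub>2 \<odot> g')\<rangle> = \<langle>g, \<psi>(a\<^sup>* a') g'\<rangle>\<close> (\<open>bounded_kernel_contraction\<close>).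

It remains to see that \<open>V\<close> maps \<open>F\<^sub>2\<close> into \<open>F\<^sub>1\<close>, that is, \<open>V L\<^sub>x = L\<^bsub>T x\<^esub>\<close>, and here the modules must be
strongly closed. An operator into \<open>K\<^sub>1\<close> whose coefficients \<open>L\<^sub>z\<^sup>* V L\<^sub>x\<close> with \<open>z \<in> X\<^sub>1\<close> lie in \<open>\<B>\<close> belongs to
\<open>F\<^sub>1\<close> (\<open>operator_eq_tens_if_coefficients_in_algebra\<close>). The coefficients for \<open>x \<in> X\<^sub>2\<close> are values of \<open>\<psi>\<close>. As
the representations may fail to be minimal, a general \<open>x \<in> F\<^sub>2\<close> needs a detour: the criterion, applied to \<open>Q L\<^sub>z\<close> for
\<open>z \<in> X\<^sub>1\<close>, shows \<open>Q L\<^sub>z = L\<^bsub>S z\<^esub>\<close>; then \<open>L\<^sub>z\<^sup>* V L\<^sub>x = \<langle>S z, x\<rangle> \<in> \<B>\<close> for every \<open>x \<in> F\<^sub>2\<close>, and finally \<open>S\<close>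
extends to all of \<open>F\<^sub>1\<close> in the same way and is the adjoint of \<open>T\<close>.

Right linearity and contractivity of \<open>T\<close> are inherited from \<open>V\<close>. Left linearity holds between generators by
the form of the kernel, and it passes to all elements because the part of \<open>F\<^sub>i\<close> with range in \<open>K\<^sub>i\<close> is
invariant under \<open>\<A>\<close> (\<open>lact_invariant_range\<close>). The formula for \<open>\<psi>\<close> is the case \<open>a = 1\<close> of the kernel identity.
\<close>

section \<open>Functionals, adjoints and projections on Hilbert spaces\<close>

lemma cinner_sum_right: "cinner x (\<Sum>i\<in>I. f i) = (\<Sum>i\<in>I. cinner x (f i :: 'a::complex_inner))"
proof (induction I rule: infinite_finite_induct)
  case (infinite I)
  then show ?case using cinner_diff_right[of x 0 0] by simp
next
  case empty
  show ?case using cinner_diff_right[of x 0 0] by simp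
qed (simp add: cinner_add_right)

lemma cinner_sum_left: "cinner (\<Sum>i\<in>I. f i) x = (\<Sum>i\<in>I. cinner (f i :: 'a::complex_inner) x)"
proof -
  have "cinner (\<Sum>i\<in>I. f i) x = cnj (\<Sum>i\<in>I. cinner x (f i))"
    by (metis cinner_commute cinner_sum_right)
  also have "\<dots> = (\<Sum>i\<in>I. cinner (f i) x)"
    unfolding cnj_sum by (intro sum.cong refl) (metis cinner_commute)
  finally show ?thesis .
qed

lemma cinner_zero_right [simp]: "cinner x (0::'a::complex_inner) = 0"
  using cinner_diff_right[of x 0 0] by simp

lemma cinner_zero_left [simp]: "cinner (0::'a::complex_inner) x = 0"
  using cinner_diff_left[of 0 0 x] by simp

lemma cinner_self_eq_0: "cinner x x = 0 \<longleftrightarrow> x = (0::'a::complex_inner)"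
  by (simp add: cinner_self)

lemma bounded_bilinear_cinner: "bounded_bilinear (cinner :: 'a::complex_inner \<Rightarrow> 'a \<Rightarrow> complex)"
  by unfold_locales
    (auto simp: cinner_add_left cinner_add_right cinner_scaleR_left cinner_scaleR_right scaleR_conv_of_real
      intro!: exI[of _ 1] cinner_Cauchy_Schwarz)

lemmas tendsto_cinner [tendsto_intros] = bounded_bilinear.tendsto[OF bounded_bilinear_cinner]

lemma clinear_add: "clinear f \<Longrightarrow> f (x + y) = f x + f y"
  and clinear_scaleC: "clinear f \<Longrightarrow> f (c *\<^sub>C x) = c *\<^sub>C f x"
  by (simp_all add: clinear_iff)

lemma clinear_zero: "clinear f \<Longrightarrow> f 0 = 0"
  using clinear_add[of f 0 0] by simp

lemma clinear_diff: "clinear f \<Longrightarrow> f (x - y) = f x - f y"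
  using clinear_add[of f "x - y" y] by simp

lemma clinear_bounded_linear:
  assumes "clinear f" "\<And>x. norm (f x) \<le> K * norm x"
  shows "bounded_linear f"
  using assms by (intro bounded_linear_intro[where K = K])
    (simp_all add: clinear_iff scaleR_scaleC mult.commute)

lemma clinear_adjoint_exists:
  fixes f :: "'a::chilbert_space \<Rightarrow> 'b::complex_inner"
  assumes "clinear f" and K: "0 \<le> K" and bound: "\<And>x. norm (f x) \<le> K * norm x"
  obtains h where "clinear h" "\<And>x y. cinner (f x) y = cinner x (h y)"
    "\<And>y. norm (h y) \<le> K * norm y"
proof -
  have "\<exists>z. \<forall>x. cinner y (f x) = cinner z x" for y
  proof (rule Riesz_representation)
    show "cmod (cinner y (f x)) \<le> (norm y * K) * norm x" for x
      using cinner_Cauchy_Schwarz[of y "f x"] mult_left_mono[OF bound[of x], of "norm y"]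
      by (simp add: mult.assoc)
  qed (use \<open>clinear f\<close> in \<open>simp_all add: clinear_iff cinner_add_right cinner_scaleC_right\<close>)
  then obtain h where h: "\<And>x y. cinner y (f x) = cinner (h y) x"
    by metis
  have h': "cinner (f x) y = cinner x (h y)" for x y
    by (metis h cinner_commute)
  have "clinear h"
    unfolding clinear_iff
    by (intro conjI allI; rule cinner_ext)
      (simp_all add: h[symmetric] cinner_add_left cinner_scaleC_left)
  moreover have "norm (h y) \<le> K * norm y" for y
  proof (cases "h y = 0")
    case True
    then show ?thesis
      using K by simp
  next
    case False
    have "(norm (h y))\<^sup>2 = cmod (cinner (h y) (h y))"
      by (simp add: cinner_self norm_power)
    also have "\<dots> = cmod (cinner y (f (h y)))"
      by (simp add: h)
    also have "\<dots> \<le> norm y * norm (f (h y))"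
      by (rule cinner_Cauchy_Schwarz)
    also have "\<dots> \<le> norm y * (K * norm (h y))"
      by (intro mult_left_mono bound) simp
    finally have "norm (h y) * norm (h y) \<le> (K * norm y) * norm (h y)"
      by (simp add: power2_eq_square mult_ac)
    with False show ?thesis
      by simp
  qed
  ultimately show ?thesis
    using that h' by blast
qed

text \<open>The Riesz representation theorem on the Hilbert space of \<open>n\<close>-tuples, for a functional that is given
only on a subspace and only as a set \<open>\<Gamma>\<close> of pairs (vector, value). Working with a relation avoids
checking that a functional defined through a choice of representatives is well defined: the bound
forces it. Minimising \<open>\<parallel>u\<parallel>\<^sup>2 - 2 Re c\<close> over \<open>\<Gamma>\<close> gives the representing tuple \<open>p\<close> as a limit of
tuples from the domain, so \<open>p\<close> lies in its closure. Tuples are needed because strong approximation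
of an operator concerns finitely many vectors simultaneously.\<close>

lemma linear_relation_representation:
  fixes \<Gamma> :: "((nat \<Rightarrow> 'h::chilbert_space) \<times> complex) set"
  assumes ne: "\<Gamma> \<noteq> {}"
    and add: "\<And>u c v d. (u, c) \<in> \<Gamma> \<Longrightarrow> (v, d) \<in> \<Gamma> \<Longrightarrow> (\<lambda>i. u i + v i, c + d) \<in> \<Gamma>"
    and scale: "\<And>s u c. (u, c) \<in> \<Gamma> \<Longrightarrow> (\<lambda>i. s *\<^sub>C u i, s * c) \<in> \<Gamma>"
    and bound: "\<And>u c. (u, c) \<in> \<Gamma> \<Longrightarrow> cmod c \<le> K * sqrt (\<Sum>i<n. (norm (u i))\<^sup>2)"
  shows "\<exists>p U. (\<forall>u c. (u, c) \<in> \<Gamma> \<longrightarrow> c = (\<Sum>i<n. cinner (p i) (u i))) \<and>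
    (\<forall>k::nat. U k \<in> Domain \<Gamma>) \<and> (\<forall>i<n. (\<lambda>k. U k i) \<longlonglongrightarrow> p i)"
proof -
  define N where "N u = (\<Sum>i<n. (norm (u i))\<^sup>2)" for u :: "nat \<Rightarrow> 'h"
  define J where "J w = N (fst w) - 2 * Re (snd w)" for w
  have N0: "0 \<le> N u" for u
    by (simp add: N_def sum_nonneg)
  have "- K\<^sup>2 \<le> J w" if "w \<in> \<Gamma>" for w
  proof -
    have "Re (snd w) \<le> K * sqrt (N (fst w))"
      using bound[of "fst w" "snd w"] that complex_Re_le_cmod[of "snd w"] by (simp add: N_def)
    moreover have "0 \<le> (sqrt (N (fst w)) - K)\<^sup>2"
      by simp
    ultimately show ?thesis
      by (simp add: J_def power2_diff N0 algebra_simps)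
  qed
  then have bdd: "bdd_below (J ` \<Gamma>)"
    unfolding bdd_below_def by blast
  define m where "m = (INF w\<in>\<Gamma>. J w)"
  have mle: "m \<le> J w" if "w \<in> \<Gamma>" for w
    unfolding m_def using bdd that by (simp add: cINF_lower)
  have "\<exists>w\<in>\<Gamma>. J w < m + 1 / real (Suc k)" for k
    using cINF_less_iff[of \<Gamma> J "m + 1 / real (Suc k)"] bdd ne by (simp add: m_def)
  then obtain W where W: "\<And>k. W k \<in> \<Gamma>" "\<And>k. J (W k) < m + 1 / real (Suc k)"
    by metis
  define U where "U k = fst (W k)" for k
  \<comment> \<open>Parallelogram identity: since the midpoint of two approximate minimisers cannot do better than
    \<open>m\<close>, the two are close to each other.\<close>
  have par: "N (\<lambda>i. fst w i - fst w' i) \<le> 2 * (J w - m) + 2 * (J w' - m)"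
    if w: "w \<in> \<Gamma>" and w': "w' \<in> \<Gamma>" for w w'
  proof -
    define z where "z = (\<lambda>i. (1/2) *\<^sub>C (fst w i + fst w' i), (1/2) * (snd w + snd w'))"
    have "z \<in> \<Gamma>"
      unfolding z_def using w w' by (intro scale add) auto
    then have "m \<le> J z" by (rule mle)
    have pl: "(norm (x - y))\<^sup>2 = 2 * (norm x)\<^sup>2 + 2 * (norm y)\<^sup>2 - 4 * (norm ((1/2) *\<^sub>C (x + y)))\<^sup>2"
      for x y :: 'h
    proof -
      have "(norm ((1/2) *\<^sub>C (x + y)))\<^sup>2 = (norm (x + y))\<^sup>2 / 4"
        by (simp add: norm_scaleC power_divide norm_divide)
      then show ?thesis
        using norm_add_sq[of x "- y"] norm_add_sq[of x y] by (simp add: cinner_minus_right)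
    qed
    have "N (\<lambda>i. fst w i - fst w' i) = 2 * N (fst w) + 2 * N (fst w') - 4 * N (fst z)"
      unfolding N_def z_def fst_conv pl sum.distrib sum_subtractf sum_distrib_left[symmetric] ..
    moreover have "J z = N (fst z) - Re (snd w) - Re (snd w')"
      by (simp add: J_def z_def field_simps)
    ultimately show ?thesis
      using \<open>m \<le> J z\<close> by (simp add: J_def)
  qed
  have "Cauchy (\<lambda>k. U k i)" if i: "i < n" for i
  proof (rule metric_CauchyI)
    fix e :: real assume "0 < e"
    then obtain M where M: "4 * (1 / real (Suc M)) < e\<^sup>2"
      using reals_Archimedean[of "e\<^sup>2 / 4"] by (auto simp: field_simps)
    have "dist (U k i) (U l i) < e" if "k \<ge> M" "l \<ge> M" for k l
    proof -
      have "1 / real (Suc k) \<le> 1 / real (Suc M)" "1 / real (Suc l) \<le> 1 / real (Suc M)"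
        using that by (simp_all add: frac_le)
      then have "N (\<lambda>i. U k i - U l i) < e\<^sup>2"
        using par[OF W(1)[of k] W(1)[of l]] W(2)[of k] W(2)[of l] M unfolding U_def by argo
      moreover have "(norm (U k i - U l i))\<^sup>2 \<le> N (\<lambda>i. U k i - U l i)"
        unfolding N_def using i by (intro member_le_sum) auto
      ultimately show ?thesis
        using \<open>0 < e\<close> unfolding dist_norm
        by (meson le_less_trans less_imp_le power_less_imp_less_base)
    qed
    then show "\<exists>M. \<forall>k\<ge>M. \<forall>l\<ge>M. dist (U k i) (U l i) < e"
      by blast
  qed
  then have "\<exists>x. (\<lambda>k. U k i) \<longlonglongrightarrow> x" if "i < n" for i
    using that Cauchy_convergent convergent_def by blast
  then obtain p where p: "\<And>i. i < n \<Longrightarrow> (\<lambda>k. U k i) \<longlonglongrightarrow> p i"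
    by metis
  \<comment> \<open>First variation of \<open>J\<close> at the minimiser in direction \<open>u\<close>; the imaginary part follows from \<open>\<i>u\<close>.\<close>
  have Re_eq: "Re c = Re (\<Sum>i<n. cinner (p i) (u i))" if uc: "(u, c) \<in> \<Gamma>" for u c
  proof -
    define \<delta> where "\<delta> = Re (\<Sum>i<n. cinner (p i) (u i)) - Re c"
    have pos: "0 \<le> 2 * t * \<delta> + t\<^sup>2 * N u" for t
    proof -
      define a where "a k = 1 / real (Suc k) + 2 * t * (Re (\<Sum>i<n. cinner (U k i) (u i)) - Re c) + t\<^sup>2 * N u" for k
      have "0 \<le> a k" for k
      proof -
        have "(\<lambda>i. U k i + of_real t *\<^sub>C u i, snd (W k) + of_real t * c) \<in> \<Gamma>"
          using W(1)[of k] uc by (intro scale add) (auto simp: U_def)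
        then have "m \<le> J (\<lambda>i. U k i + of_real t *\<^sub>C u i, snd (W k) + of_real t * c)"
          by (rule mle)
        also have "\<dots> = J (W k) + 2 * t * (Re (\<Sum>i<n. cinner (U k i) (u i)) - Re c) + t\<^sup>2 * N u"
          by (simp add: J_def N_def norm_add_sq norm_scaleC power_mult_distrib cinner_scaleC_right
              sum.distrib sum_distrib_left U_def algebra_simps)
        finally show ?thesis
          using W(2)[of k] by (simp add: a_def)
      qed
      moreover have "a \<longlonglongrightarrow> 0 + 2 * t * \<delta> + t\<^sup>2 * N u"
        unfolding a_def \<delta>_def
        by (intro tendsto_intros LIMSEQ_Suc[OF lim_1_over_n] p) simp_all
      ultimately show ?thesis
        using LIMSEQ_le_const[of a "2 * t * \<delta> + t\<^sup>2 * N u" 0] by simp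
    qed
    have "\<delta> = 0"
    proof (rule ccontr)
      assume "\<delta> \<noteq> 0"
      define t where "t = - \<delta> / (N u + 1)"
      have Np: "0 < N u + 1"
        using N0[of u] by simp
      have "2 * t * \<delta> + t\<^sup>2 * N u \<le> 2 * t * \<delta> + t\<^sup>2 * (N u + 1)"
        by (simp add: algebra_simps)
      also have "\<dots> = - (\<delta>\<^sup>2 / (N u + 1))"
        using Np by (simp add: t_def power2_eq_square)
      also have "\<dots> < 0"
        using Np \<open>\<delta> \<noteq> 0\<close> by simp
      finally show False
        using pos[of t] by simp
    qed
    then show ?thesis
      by (simp add: \<delta>_def)
  qed
  have "c = (\<Sum>i<n. cinner (p i) (u i))" if uc: "(u, c) \<in> \<Gamma>" for u c
  proof (rule complex_eqI)
    show "Im c = Im (\<Sum>i<n. cinner (p i) (u i))"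
      using Re_eq[OF scale[OF uc, of \<i>]] by (simp add: cinner_scaleC_right sum_distrib_left[symmetric])
  qed (rule Re_eq[OF uc])
  then show ?thesis
    using W(1) p U_def by (intro exI[of _ p] exI[of _ U]) (auto simp: Domain_fst)
qed

text \<open>For single vectors the representing vector inherits the bound of the functional, because it is a
limit of vectors on which that bound holds.\<close>

lemma linear_relation_representation_single:
  fixes \<Gamma> :: "('h::chilbert_space \<times> complex) set"
  assumes ne: "\<Gamma> \<noteq> {}"
    and add: "\<And>u c v d. (u, c) \<in> \<Gamma> \<Longrightarrow> (v, d) \<in> \<Gamma> \<Longrightarrow> (u + v, c + d) \<in> \<Gamma>"
    and scale: "\<And>s u c. (u, c) \<in> \<Gamma> \<Longrightarrow> (s *\<^sub>C u, s * c) \<in> \<Gamma>"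
    and K: "0 \<le> K" and bound: "\<And>u c. (u, c) \<in> \<Gamma> \<Longrightarrow> cmod c \<le> K * norm u"
  shows "\<exists>p \<in> closure (Domain \<Gamma>). norm p \<le> K \<and> (\<forall>u c. (u, c) \<in> \<Gamma> \<longrightarrow> c = cinner p u)"
proof -
  define \<Gamma>' :: "((nat \<Rightarrow> 'h) \<times> complex) set" where "\<Gamma>' = {(u, c). (u 0, c) \<in> \<Gamma>}"
  have ne': "\<Gamma>' \<noteq> {}"
  proof -
    obtain u c where "(u, c) \<in> \<Gamma>"
      using ne by auto
    then have "(\<lambda>_. u, c) \<in> \<Gamma>'"
      by (simp add: \<Gamma>'_def)
    then show ?thesis
      by blast
  qed
  have bound': "cmod c \<le> K * sqrt (\<Sum>i<1. (norm (u i))\<^sup>2)" if "(u, c) \<in> \<Gamma>'" for u c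
    using that bound by (simp add: \<Gamma>'_def)
  have add': "(\<lambda>i. u i + v i, c + d) \<in> \<Gamma>'" if "(u, c) \<in> \<Gamma>'" "(v, d) \<in> \<Gamma>'" for u c v d
    using that add by (simp add: \<Gamma>'_def)
  have scale': "(\<lambda>i. s *\<^sub>C u i, s * c) \<in> \<Gamma>'" if "(u, c) \<in> \<Gamma>'" for s u c
    using that scale by (simp add: \<Gamma>'_def)
  have "\<exists>p U. (\<forall>u c. (u, c) \<in> \<Gamma>' \<longrightarrow> c = (\<Sum>i<1. cinner (p i) (u i))) \<and>
      (\<forall>k::nat. U k \<in> Domain \<Gamma>') \<and> (\<forall>i<1. (\<lambda>k. U k i) \<longlonglongrightarrow> p i)"
    by (rule linear_relation_representation[OF ne' add' scale' bound'])
  then obtain p and U :: "nat \<Rightarrow> nat \<Rightarrow> 'h" where rep: "\<forall>u c. (u, c) \<in> \<Gamma>' \<longrightarrow> c = (\<Sum>i<1. cinner (p i) (u i))"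
    and U: "\<forall>k. U k \<in> Domain \<Gamma>'" and lim: "\<forall>i<1. (\<lambda>k. U k i) \<longlonglongrightarrow> p i"
    by (elim exE conjE)
  have rep: "c = cinner (p 0) u" if "(u, c) \<in> \<Gamma>" for u c
    using rep[rule_format, of "\<lambda>_. u" c] that by (simp add: \<Gamma>'_def)
  have U0: "U k 0 \<in> Domain \<Gamma>" for k
    using U[rule_format, of k] by (auto simp: \<Gamma>'_def)
  have lim0: "(\<lambda>k. U k 0) \<longlonglongrightarrow> p 0"
    using lim by simp
  have "p 0 \<in> closure (Domain \<Gamma>)"
    unfolding closure_sequential using U0 lim0 by (intro exI[of _ "\<lambda>k. U k 0"]) simp
  moreover have "norm (p 0) \<le> K"
  proof (cases "p 0 = 0")
    case True
    then show ?thesis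
      using True K by simp
  next
    case False
    have "cmod (cinner (p 0) (U k 0)) \<le> K * norm (U k 0)" for k
    proof -
      obtain c where "(U k 0, c) \<in> \<Gamma>"
        using U0[of k] by blast
      then show ?thesis
        using rep[of "U k 0" c] bound[of "U k 0" c] by simp
    qed
    then have "cmod (cinner (p 0) (p 0)) \<le> K * norm (p 0)"
      using lim0 by (intro LIMSEQ_le[of "\<lambda>k. cmod (cinner (p 0) (U k 0))" _ "\<lambda>k. K * norm (U k 0)"] tendsto_intros) auto
    with False show ?thesis
      by (simp add: cinner_self norm_mult power2_eq_square)
  qed
  ultimately show ?thesis
    using rep by blast
qed

lemma csubspace_cspan: "csubspace (cspan S)"
  by (simp add: csubspace_def cspan_def complex_vector.subspace_span)

lemma cspan_base: "x \<in> S \<Longrightarrow> x \<in> cspan S"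
  by (simp add: cspan_def complex_vector.span_base)

lemma csubspace_0: "csubspace S \<Longrightarrow> 0 \<in> S"
  and csubspace_add: "csubspace S \<Longrightarrow> x \<in> S \<Longrightarrow> y \<in> S \<Longrightarrow> x + y \<in> S"
  and csubspace_scaleC: "csubspace S \<Longrightarrow> x \<in> S \<Longrightarrow> c *\<^sub>C x \<in> S"
  and csubspace_diff: "csubspace S \<Longrightarrow> x \<in> S \<Longrightarrow> y \<in> S \<Longrightarrow> x - y \<in> S"
  by (simp_all add: csubspace_def complex_vector.subspace_0 complex_vector.subspace_add
      complex_vector.subspace_scale complex_vector.subspace_diff)

lemma cspan_minimal: "S \<subseteq> T \<Longrightarrow> csubspace T \<Longrightarrow> cspan S \<subseteq> T"
  by (simp add: cspan_def csubspace_def complex_vector.span_minimal)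

lemma csubspace_closure:
  fixes S :: "'a::complex_normed_vector set"
  assumes "csubspace S"
  shows "csubspace (closure S)"
proof -
  have "x + y \<in> closure S" if xy: "x \<in> closure S" "y \<in> closure S" for x y
  proof -
    obtain X Y where "\<And>n. X n \<in> S" "X \<longlonglongrightarrow> x" "\<And>n. Y n \<in> S" "Y \<longlonglongrightarrow> y"
      using xy unfolding closure_sequential by auto
    then show ?thesis
      using assms unfolding closure_sequential
      by (intro exI[of _ "\<lambda>n. X n + Y n"]) (auto intro: tendsto_add csubspace_add)
  qed
  moreover have "c *\<^sub>C x \<in> closure S" if x: "x \<in> closure S" for c x
  proof -
    obtain X where "\<And>n. X n \<in> S" "X \<longlonglongrightarrow> x"
      using x unfolding closure_sequential by auto
    then show ?thesis
      using assms unfolding closure_sequential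
      by (intro exI[of _ "\<lambda>n. c *\<^sub>C X n"])
        (auto intro: bounded_linear.tendsto[OF bounded_linear_scaleC] csubspace_scaleC)
  qed
  moreover have "0 \<in> closure S"
    using assms csubspace_0 closure_subset by blast
  ultimately show ?thesis
    unfolding csubspace_def by (intro complex_vector.subspaceI)
qed

lemma orthogonal_closure_cspan:
  fixes h :: "'h::complex_inner"
  assumes "\<And>x. x \<in> X \<Longrightarrow> cinner h x = 0" "y \<in> closure (cspan X)"
  shows "cinner h y = 0"
proof -
  have "csubspace {y. cinner h y = 0}"
    unfolding csubspace_def
    by (rule complex_vector.subspaceI) (simp_all add: cinner_add_right cinner_scaleC_right)
  then have "cspan X \<subseteq> {y. cinner h y = 0}"
    using assms(1) by (intro cspan_minimal) auto
  moreover have "closed {y. cinner h y = 0}"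
    by (intro closed_Collect_eq continuous_intros
        bounded_linear.continuous_on[OF bounded_bilinear.bounded_linear_right[OF bounded_bilinear_cinner]])
  ultimately have "closure (cspan X) \<subseteq> {y. cinner h y = 0}"
    by (rule closure_minimal)
  with assms(2) show ?thesis
    by blast
qed

text \<open>Identities between vectors of a closed span are verified throughout by pairing with the generators,
which is what this lemma and the next allow.\<close>

lemma orthogonal_closure_cspan_eq_0:
  fixes h :: "'h::complex_inner"
  assumes "h \<in> closure (cspan X)" "\<And>x. x \<in> X \<Longrightarrow> cinner x h = 0"
  shows "h = 0"
proof -
  have "cinner h x = 0" if "x \<in> X" for x
    using assms(2)[OF that] by (metis cinner_commute complex_cnj_zero)
  then show ?thesis
    using orthogonal_closure_cspan[of X h h] assms(1) by (simp add: cinner_self_eq_0)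
qed

lemma closure_cspan_eqI:
  fixes h :: "'h::complex_inner"
  assumes "h \<in> closure (cspan X)" "h' \<in> closure (cspan X)" "\<And>x. x \<in> X \<Longrightarrow> cinner x h = cinner x h'"
  shows "h = h'"
  using orthogonal_closure_cspan_eq_0[of "h - h'" X] assms
  by (simp add: cinner_diff_right csubspace_diff csubspace_closure csubspace_cspan)

lemma orthogonal_projection_exists:
  fixes h :: "'h::chilbert_space"
  obtains p where "p \<in> closure (cspan X)" "norm p \<le> norm h" "\<And>x. x \<in> X \<Longrightarrow> cinner x p = cinner x h"
proof -
  define \<Gamma> where "\<Gamma> = {(u, cinner h u) | u. u \<in> cspan X}"
  have ne: "\<Gamma> \<noteq> {}"
    using csubspace_0[OF csubspace_cspan[of X]] by (auto simp: \<Gamma>_def)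
  have add: "(u + v, c + d) \<in> \<Gamma>" if "(u, c) \<in> \<Gamma>" "(v, d) \<in> \<Gamma>" for u v c d
    using that csubspace_add[OF csubspace_cspan] by (auto simp: \<Gamma>_def cinner_add_right)
  have scale: "(s *\<^sub>C u, s * c) \<in> \<Gamma>" if "(u, c) \<in> \<Gamma>" for s u c
    using that csubspace_scaleC[OF csubspace_cspan] by (auto simp: \<Gamma>_def cinner_scaleC_right)
  have bound: "cmod c \<le> norm h * norm u" if "(u, c) \<in> \<Gamma>" for u c
    using that by (auto simp: \<Gamma>_def cinner_Cauchy_Schwarz)
  have "\<exists>p \<in> closure (Domain \<Gamma>). norm p \<le> norm h \<and> (\<forall>u c. (u, c) \<in> \<Gamma> \<longrightarrow> c = cinner p u)"
    by (rule linear_relation_representation_single[OF ne add scale norm_ge_zero bound])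
  then obtain p where p: "p \<in> closure (Domain \<Gamma>)" "norm p \<le> norm h"
    "\<forall>u c. (u, c) \<in> \<Gamma> \<longrightarrow> c = cinner p u"
    by (elim bexE conjE)
  have "cinner x p = cinner x h" if "x \<in> X" for x
  proof -
    have "cinner h x = cinner p x"
      using that by (intro p(3)[rule_format]) (auto simp: \<Gamma>_def cspan_base)
    then show ?thesis
      by (metis cinner_commute)
  qed
  moreover have "Domain \<Gamma> = cspan X"
    by (auto simp: \<Gamma>_def)
  ultimately show ?thesis
    using that p by simp
qed

section \<open>The contraction defined by a bounded kernel\<close>

text \<open>A scalar kernel \<open>\<beta>\<close> that is dominated by the norms of finite linear combinations is the matrix of a
contraction. The bound says that \<open>\<beta>\<close> descends to a bounded sesquilinear form on the spans of \<open>e\<close>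
and \<open>f\<close>. Representing it in the first variable gives \<open>W\<close> on formal combinations; representing
\<open>\<langle>k, W s\<rangle>\<close> in the second variable gives \<open>Q\<close> on the whole space, and \<open>V\<close> is its adjoint. Since
\<open>Q\<close> vanishes on the orthogonal complement of the span of \<open>e\<close>, the range of \<open>V\<close> stays in its closure.\<close>

lemma bounded_kernel_contraction:
  fixes e :: "'i \<Rightarrow> 'h::chilbert_space" and f :: "'j \<Rightarrow> 'k::chilbert_space"
    and \<beta> :: "'i \<Rightarrow> 'j \<Rightarrow> complex"
  assumes bound: "\<And>r s. cmod (\<Sum>(c, i)\<leftarrow>r. \<Sum>(d, j)\<leftarrow>s. cnj c * d * \<beta> i j)
    \<le> norm (\<Sum>(c, i)\<leftarrow>r. c *\<^sub>C e i) * norm (\<Sum>(d, j)\<leftarrow>s. d *\<^sub>C f j)"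
  obtains V :: "'k \<Rightarrow> 'h" and Q :: "'h \<Rightarrow> 'k" where
    "clinear V" "clinear Q" "\<And>x. norm (V x) \<le> norm x" "\<And>y. norm (Q y) \<le> norm y"
    "\<And>x y. cinner (V x) y = cinner x (Q y)"
    "\<And>x. V x \<in> closure (cspan (range e))" "\<And>y. Q y \<in> closure (cspan (range f))"
    "\<And>i j. cinner (e i) (V (f j)) = \<beta> i j"
proof -
  \<comment> \<open>Formal linear combinations are lists of (coefficient, generator): addition is concatenation.\<close>
  define v where "v r = (\<Sum>(c, i)\<leftarrow>r. c *\<^sub>C e i)" for r
  define w where "w s = (\<Sum>(d, j)\<leftarrow>s. d *\<^sub>C f j)" for s
  define b where "b r s = (\<Sum>(c, i)\<leftarrow>r. \<Sum>(d, j)\<leftarrow>s. cnj c * d * \<beta> i j)" for r s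
  define sc :: "complex \<Rightarrow> (complex \<times> 'i) list \<Rightarrow> (complex \<times> 'i) list"
    where "sc t = map (\<lambda>(c, i). (t * c, i))" for t
  define sc' :: "complex \<Rightarrow> (complex \<times> 'j) list \<Rightarrow> (complex \<times> 'j) list"
    where "sc' t = map (\<lambda>(c, i). (t * c, i))" for t
  have v_append: "v (r @ r') = v r + v r'" for r r'
    by (simp add: v_def)
  have w_append: "w (s @ s') = w s + w s'" for s s'
    by (simp add: w_def)
  have v_sc: "v (sc t r) = t *\<^sub>C v r" for t r
    by (induction r) (auto simp: v_def sc_def scaleC_add_right scaleC_scaleC)
  have w_sc: "w (sc' t s) = t *\<^sub>C w s" for t s
    by (induction s) (auto simp: w_def sc'_def scaleC_add_right scaleC_scaleC)
  have b_append: "b (r @ r') s = b r s + b r' s" for r r' s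
    by (simp add: b_def)
  have b_append': "b r (s @ s') = b r s + b r s'" for r s s'
    by (induction r) (auto simp: b_def)
  have b_sc_inner: "(\<Sum>(d, j)\<leftarrow>s. cnj t * cnj c * d * \<beta> i j) = cnj t * (\<Sum>(d, j)\<leftarrow>s. cnj c * d * \<beta> i j)"
    for t c s i
    by (induction s) (auto simp: algebra_simps)
  have b_sc: "b (sc t r) s = cnj t * b r s" for t r s
    by (induction r) (auto simp: b_def sc_def b_sc_inner distrib_left)
  have b_sc_inner': "(\<Sum>(d, j)\<leftarrow>sc' t s. cnj c * d * \<beta> i j) = t * (\<Sum>(d, j)\<leftarrow>s. cnj c * d * \<beta> i j)"
    for t c s i
    by (induction s) (auto simp: sc'_def algebra_simps)
  have b_sc': "b r (sc' t s) = t * b r s" for t r s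
    by (induction r) (auto simp: b_def b_sc_inner' distrib_left)
  have b_bound: "cmod (b r s) \<le> norm (v r) * norm (w s)" for r s
    using bound by (simp add: b_def v_def w_def)
  have v_cspan: "v r \<in> cspan (range e)" for r
    by (induction r)
      (auto simp: v_def csubspace_0 csubspace_add csubspace_scaleC csubspace_cspan cspan_base)
  have w_cspan: "w s \<in> cspan (range f)" for s
    by (induction s)
      (auto simp: w_def csubspace_0 csubspace_add csubspace_scaleC csubspace_cspan cspan_base)
  have e_eq: "e i = v [(1, i)]" for i
    by (simp add: v_def scaleC_one)
  have f_eq: "f j = w [(1, j)]" for j
    by (simp add: w_def scaleC_one)

  have "\<exists>p. p \<in> closure (cspan (range e)) \<and> norm p \<le> norm (w s) \<and> (\<forall>r. b r s = cinner (v r) p)" for s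
  proof -
    define \<Gamma> where "\<Gamma> = {(v r, cnj (b r s)) | r. True}"
    have ne: "\<Gamma> \<noteq> {}"
      by (auto simp: \<Gamma>_def)
    have add: "(x + y, c + d) \<in> \<Gamma>" if "(x, c) \<in> \<Gamma>" "(y, d) \<in> \<Gamma>" for x c y d
      using that unfolding \<Gamma>_def by (auto simp: v_append[symmetric] b_append simp flip: complex_cnj_add)
    have scale: "(t *\<^sub>C x, t * c) \<in> \<Gamma>" if xc: "(x, c) \<in> \<Gamma>" for t x c
    proof -
      obtain r where "x = v r" "c = cnj (b r s)"
        using xc by (auto simp: \<Gamma>_def)
      then show ?thesis
        unfolding \<Gamma>_def by (auto simp: v_sc b_sc intro!: exI[of _ "sc t r"])
    qed
    have bd: "cmod c \<le> norm (w s) * norm x" if "(x, c) \<in> \<Gamma>" for x c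
      using that b_bound by (auto simp: \<Gamma>_def mult.commute)
    have "\<exists>p \<in> closure (Domain \<Gamma>). norm p \<le> norm (w s) \<and> (\<forall>x c. (x, c) \<in> \<Gamma> \<longrightarrow> c = cinner p x)"
      by (rule linear_relation_representation_single[OF ne add scale norm_ge_zero bd])
    then obtain p where p: "p \<in> closure (Domain \<Gamma>)" "norm p \<le> norm (w s)"
      "\<forall>x c. (x, c) \<in> \<Gamma> \<longrightarrow> c = cinner p x"
      by (elim bexE conjE)
    have "closure (Domain \<Gamma>) \<subseteq> closure (cspan (range e))"
      by (rule closure_mono) (auto simp: \<Gamma>_def v_cspan)
    moreover have "b r s = cinner (v r) p" for r
    proof -
      have "cnj (b r s) = cinner p (v r)"
        using p(3) by (auto simp: \<Gamma>_def)
      then show ?thesis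
        by (metis cinner_commute complex_cnj_cnj)
    qed
    ultimately show ?thesis
      using p by blast
  qed
  then obtain W where W: "\<And>s. W s \<in> closure (cspan (range e))" "\<And>s. norm (W s) \<le> norm (w s)"
    "\<And>r s. b r s = cinner (v r) (W s)"
    by metis
  have e_W: "cinner (e i) (W s) = b [(1, i)] s" for i s
    by (simp add: e_eq W)
  have W_append: "W (s @ s') = W s + W s'" for s s'
    by (rule closure_cspan_eqI[where X = "range e"])
      (auto simp: W(1) csubspace_add csubspace_closure csubspace_cspan cinner_add_right e_W b_append')
  have W_sc: "W (sc' t s) = t *\<^sub>C W s" for t s
    by (rule closure_cspan_eqI[where X = "range e"])
      (auto simp: W(1) csubspace_scaleC csubspace_closure csubspace_cspan cinner_scaleC_right e_W b_sc')

  have "\<exists>p. p \<in> closure (cspan (range f)) \<and> norm p \<le> norm k \<and> (\<forall>s. cinner k (W s) = cinner p (w s))" for k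
  proof -
    define \<Gamma> where "\<Gamma> = {(w s, cinner k (W s)) | s. True}"
    have ne: "\<Gamma> \<noteq> {}"
      by (auto simp: \<Gamma>_def)
    have add: "(x + y, c + d) \<in> \<Gamma>" if "(x, c) \<in> \<Gamma>" "(y, d) \<in> \<Gamma>" for x c y d
      using that unfolding \<Gamma>_def by (auto simp: w_append[symmetric] W_append simp flip: cinner_add_right)
    have scale: "(t *\<^sub>C x, t * c) \<in> \<Gamma>" if xc: "(x, c) \<in> \<Gamma>" for t x c
    proof -
      obtain s where "x = w s" "c = cinner k (W s)"
        using xc by (auto simp: \<Gamma>_def)
      then show ?thesis
        unfolding \<Gamma>_def by (auto simp: w_sc W_sc cinner_scaleC_right intro!: exI[of _ "sc' t s"])
    qed
    have bd: "cmod c \<le> norm k * norm x" if "(x, c) \<in> \<Gamma>" for x c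
      using that W(2) by (auto simp: \<Gamma>_def intro!: order_trans[OF cinner_Cauchy_Schwarz] mult_left_mono)
    have "\<exists>p \<in> closure (Domain \<Gamma>). norm p \<le> norm k \<and> (\<forall>x c. (x, c) \<in> \<Gamma> \<longrightarrow> c = cinner p x)"
      by (rule linear_relation_representation_single[OF ne add scale norm_ge_zero bd])
    then obtain p where p: "p \<in> closure (Domain \<Gamma>)" "norm p \<le> norm k"
      "\<forall>x c. (x, c) \<in> \<Gamma> \<longrightarrow> c = cinner p x"
      by (elim bexE conjE)
    have "closure (Domain \<Gamma>) \<subseteq> closure (cspan (range f))"
      by (rule closure_mono) (auto simp: \<Gamma>_def w_cspan)
    moreover have "\<forall>s. cinner k (W s) = cinner p (w s)"
      using p(3) by (auto simp: \<Gamma>_def)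
    ultimately show ?thesis
      using p by blast
  qed
  then obtain Q where Q: "\<And>k. Q k \<in> closure (cspan (range f))" "\<And>k. norm (Q k) \<le> norm k"
    "\<And>k s. cinner k (W s) = cinner (Q k) (w s)"
    by metis
  have f_Q: "cinner (f j) (Q k) = cinner (W [(1, j)]) k" for j k
    by (metis Q(3) cinner_commute f_eq)
  have "Q (x + y) = Q x + Q y" for x y
    by (rule closure_cspan_eqI[where X = "range f"])
      (auto simp: Q(1) csubspace_add csubspace_closure csubspace_cspan cinner_add_right f_Q)
  moreover have "Q (t *\<^sub>C x) = t *\<^sub>C Q x" for t x
    by (rule closure_cspan_eqI[where X = "range f"])
      (auto simp: Q(1) csubspace_scaleC csubspace_closure csubspace_cspan cinner_scaleC_right f_Q)
  ultimately have Q_lin: "clinear Q"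
    by (simp add: clinear_iff)
  have Q_bd: "norm (Q y) \<le> 1 * norm y" for y
    by (simp add: Q)
  obtain V where V: "clinear V" "\<And>x y. cinner (Q x) y = cinner x (V y)" "\<And>y. norm (V y) \<le> 1 * norm y"
    using clinear_adjoint_exists[OF Q_lin _ Q_bd] by (metis zero_le_one)
  have VQ: "cinner (V x) y = cinner x (Q y)" for x y
    by (metis V(2) cinner_commute)
  have "cinner (e i) (V (f j)) = \<beta> i j" for i j
  proof -
    have "cinner (e i) (V (f j)) = cinner (Q (e i)) (w [(1, j)])"
      by (simp add: V(2) f_eq)
    also have "\<dots> = b [(1, i)] [(1, j)]"
      by (simp add: e_W flip: Q(3))
    finally show ?thesis
      by (simp add: b_def)
  qed
  \<comment> \<open>The component \<open>k\<close> of \<open>V h\<close> orthogonal to the span satisfies \<open>\<langle>k, k\<rangle> = \<langle>k, V h\<rangle> = \<langle>Q k, h\<rangle> = 0\<close>.\<close>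
  moreover have "V h \<in> closure (cspan (range e))" for h
  proof -
    obtain p where p: "p \<in> closure (cspan (range e))" "\<And>x. x \<in> range e \<Longrightarrow> cinner x p = cinner x (V h)"
      using orthogonal_projection_exists[of "range e" "V h"] by metis
    define k where "k = V h - p"
    have "cinner k x = 0" if "x \<in> range e" for x
      using p(2)[OF that] by (metis cinner_commute cinner_diff_right complex_cnj_zero k_def right_minus_eq)
    then have k: "cinner k x = 0" if "x \<in> closure (cspan (range e))" for x
      using orthogonal_closure_cspan that by blast
    have "cinner (f j) (Q k) = 0" for j
      unfolding f_Q using k[OF W(1)] by (metis cinner_commute complex_cnj_zero)
    then have "Q k = 0"
      using Q(1) by (intro orthogonal_closure_cspan_eq_0[of _ "range f"]) auto
    then have "cinner k (V h) = 0"
      using V(2)[of k h] by simp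
    then have "cinner k k = 0"
      using k[OF p(1)] by (simp add: k_def cinner_diff_right)
    then show ?thesis
      using p(1) by (simp add: cinner_self_eq_0 k_def)
  qed
  ultimately show ?thesis
    using that[of V Q] V(1,3) Q_lin Q(1,2) VQ by simp
qed

lemma orthogonal_projection_operator:
  fixes X :: "'h::chilbert_space set"
  obtains P where "clinear P" "\<And>h. norm (P h) \<le> norm h" "\<And>h. P h \<in> closure (cspan X)"
    "\<And>x h. x \<in> X \<Longrightarrow> cinner x (P h) = cinner x h"
proof -
  have "\<exists>p. p \<in> closure (cspan X) \<and> norm p \<le> norm h \<and> (\<forall>x\<in>X. cinner x p = cinner x h)" for h
    by (rule orthogonal_projection_exists[of X h]) blast
  then obtain P where P: "\<And>h. P h \<in> closure (cspan X)" "\<And>h. norm (P h) \<le> norm h"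
    "\<And>h x. x \<in> X \<Longrightarrow> cinner x (P h) = cinner x h"
    by metis
  have "P (x + y) = P x + P y" for x y
    by (rule closure_cspan_eqI[where X = X])
      (auto simp: P csubspace_add csubspace_closure csubspace_cspan cinner_add_right)
  moreover have "P (t *\<^sub>C x) = t *\<^sub>C P x" for t x
    by (rule closure_cspan_eqI[where X = X])
      (auto simp: P csubspace_scaleC csubspace_closure csubspace_cspan cinner_scaleC_right)
  ultimately show ?thesis
    using that[of P] P by (simp add: clinear_iff)
qed

section \<open>Strong closedness\<close>

text \<open>A basic strong neighbourhood constrains an operator only at finitely many vectors, so approximation
on finite sets suffices.\<close>

lemma strong_operator_closed_approx:
  fixes A :: "('g::real_normed_vector \<Rightarrow>\<^sub>L 'h::real_normed_vector) set"
  assumes closed: "closedin strong_operator_topology A"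
    and approx: "\<And>F e. finite F \<Longrightarrow> 0 < e \<Longrightarrow>
      \<exists>T\<in>A. \<forall>x\<in>F. norm (blinfun_apply S x - blinfun_apply T x) < e"
  shows "S \<in> A"
proof (rule ccontr)
  assume "S \<notin> A"
  have "openin strong_operator_topology (UNIV - A)"
    using closed by (simp add: closedin_def strong_operator_topology_topspace)
  then obtain U where U: "open U" "UNIV - A = blinfun_apply -` U"
    by (auto simp: strong_operator_topology_def openin_pullback_topology)
  have "openin (product_topology (\<lambda>_. euclidean) UNIV) U" "blinfun_apply S \<in> U"
    using U \<open>S \<notin> A\<close> by (auto simp: euclidean_product_topology)
  then obtain X where X: "blinfun_apply S \<in> (\<Pi>\<^sub>E i\<in>UNIV. X i)" "\<And>i. open (X i)"
    "finite {i. X i \<noteq> UNIV}" "(\<Pi>\<^sub>E i\<in>UNIV. X i) \<subseteq> U"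
    using product_topology_open_contains_basis[of "\<lambda>_. euclidean" UNIV U "blinfun_apply S"] by auto
  define F where "F = {i. X i \<noteq> UNIV}"
  have "\<exists>e>0. ball (blinfun_apply S i) e \<subseteq> X i" for i
  proof -
    have "blinfun_apply S i \<in> X i"
      using X(1) by blast
    then show ?thesis
      using X(2)[of i] by (meson openE)
  qed
  then obtain \<epsilon> where \<epsilon>: "\<And>i. 0 < \<epsilon> i" "\<And>i. ball (blinfun_apply S i) (\<epsilon> i) \<subseteq> X i"
    by metis
  define e where "e = Min (insert 1 (\<epsilon> ` F))"
  have fin: "finite F"
    using X(3) by (simp add: F_def)
  then have "0 < e"
    using \<epsilon>(1) by (simp add: e_def)
  then obtain T where T: "T \<in> A" "\<And>x. x \<in> F \<Longrightarrow> norm (blinfun_apply S x - blinfun_apply T x) < e"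
    using approx[OF fin] by blast
  have "blinfun_apply T i \<in> X i" for i
  proof (cases "i \<in> F")
    case True
    then have "e \<le> \<epsilon> i"
      using fin by (auto simp: e_def intro!: Min_le)
    then show ?thesis
      using T(2)[OF True] \<epsilon>(2)[of i] by (auto simp: dist_norm subset_iff)
  qed (simp add: F_def)
  then have "blinfun_apply T \<in> U"
    using X(4) by (auto simp: PiE_UNIV_domain)
  then show False
    using U(2) T(1) by auto
qed

section \<open>Von Neumann modules as spaces of operators\<close>

lemma cinner_bop_star: "cinner x (bop_apply (star T) y) = cinner (bop_apply T x) y"
  by (metis cinner_commute cinner_star_bop)

lemma bop_apply_zero_left: "bop_apply 0 x = 0"
  by transfer simp

lemma bop_apply_diff: "bop_apply (S - T) x = bop_apply S x - bop_apply T x"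
  by transfer (simp add: blinfun.bilinear_simps)

lemma bop_eqI_cinner:
  assumes "\<And>g g'. cinner g (bop_apply S g') = cinner g (bop_apply T g')"
  shows "S = T"
  by (rule bop_eqI, rule cinner_ext) (metis assms cinner_commute)

locale vn_module = hilbert_module B ip ract
  for B :: "'g::chilbert_space bop set"
    and ip :: "'e::complex_banach \<Rightarrow> 'e \<Rightarrow> 'g bop"
    and ract :: "'e \<Rightarrow> 'g bop \<Rightarrow> 'e" +
  fixes tens :: "'e \<Rightarrow> 'g \<Rightarrow> 'h::chilbert_space"
  assumes vn_algebra: "von_neumann_algebra B"
    and vn_mod: "von_neumann_module B ip ract tens"
begin

lemma B_subspace: "csubspace B"
  and B_star: "T \<in> B \<Longrightarrow> star T \<in> B"
  using vn_algebra by (auto simp: von_neumann_algebra_def)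

lemma tens_inner: "cinner (tens x g) (tens x' g') = cinner g (bop_apply (ip x x') g')"
  and tens_total: "closure (cspan {tens x g | x g. True}) = UNIV"
  using vn_mod by (auto simp: von_neumann_module_def interior_tensor_def)

lemma tens_closed: "closedin strong_operator_topology (range (\<lambda>x. Blinfun (tens x)))"
  using vn_mod by (simp add: von_neumann_module_def)

lemma tens_total_eqI: "(\<And>x g. cinner (tens x g) u = cinner (tens x g) v) \<Longrightarrow> u = v"
  by (rule closure_cspan_eqI[where X = "{tens x g | x g. True}"]) (unfold tens_total, auto)

lemma tens_clinear: "clinear (tens x)"
  unfolding clinear_iff
  by (intro conjI allI; rule tens_total_eqI)
    (simp_all add: tens_inner bop_apply_add bop_apply_scaleC cinner_add_right cinner_scaleC_right)

lemma tens_clinear_left: "clinear (\<lambda>x. tens x g)"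
  unfolding clinear_iff
  by (intro conjI allI; rule tens_total_eqI)
    (simp_all add: tens_inner clinear_add[OF ip_clinear] clinear_scaleC[OF ip_clinear]
      bop_apply_plus scaleC_bop_apply cinner_add_right cinner_scaleC_right)

lemma tens_ract: "b \<in> B \<Longrightarrow> tens (ract x b) g = tens x (bop_apply b g)"
  by (rule tens_total_eqI) (simp add: tens_inner ip_ract bop_apply_times)

lemma norm_eq_bop:
  obtains b where "norm x = norm b" "\<And>g. norm (tens x g) = norm (bop_apply b g)"
proof -
  obtain b where b: "b \<in> B" "ip x x = star b * b"
    using ip_positive by blast
  have "norm x = norm b"
    by (simp add: norm_eq[of x] b(2) cstar_identity)
  moreover have "norm (tens x g) = norm (bop_apply b g)" for g
  proof -
    have "complex_of_real ((norm (tens x g))\<^sup>2) = cinner (bop_apply b g) (bop_apply b g)"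
      by (metis b(2) bop_apply_times cinner_bop_star cinner_self tens_inner)
    then have "(norm (tens x g))\<^sup>2 = (norm (bop_apply b g))\<^sup>2"
      by (simp only: cinner_self of_real_eq_iff)
    then show ?thesis
      by simp
  qed
  ultimately show ?thesis
    using that by blast
qed

lemma norm_tens_le: "norm (tens x g) \<le> norm x * norm g"
  by (metis norm_bop_apply norm_eq_bop)

lemma norm_le_if_norm_tens_le:
  assumes "0 \<le> K" "\<And>g. norm (tens x g) \<le> K * norm g"
  shows "norm x \<le> K"
proof -
  obtain b where b: "norm x = norm b" "\<And>g. norm (tens x g) = norm (bop_apply b g)"
    using norm_eq_bop[of x] by blast
  have "norm b \<le> K"
    unfolding norm_bop.rep_eq
    by (rule norm_blinfun_bound) (use assms b in \<open>simp_all flip: bop_apply.rep_eq\<close>)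
  then show ?thesis
    by (simp add: b)
qed

lemma tens_eqI:
  assumes "\<And>g. tens x g = tens y g"
  shows "x = y"
proof -
  have "norm (x - y) \<le> 0"
    by (rule norm_le_if_norm_tens_le) (simp_all add: clinear_diff[OF tens_clinear_left] assms)
  then show ?thesis
    by simp
qed

lemma bounded_linear_tens: "bounded_linear (tens x)"
  by (rule clinear_bounded_linear[OF tens_clinear norm_tens_le])

text \<open>The form of the double commutant theorem that is needed. Let \<open>M\<close> be the closed span of \<open>x \<odot> g\<close> with
\<open>x \<in> X\<close>. An operator \<open>S\<close> into \<open>M\<close> all of whose coefficients \<open>L\<^sub>x\<^sup>* S\<close> lie in \<open>B\<close> is a strong limit
of elements of \<open>D\<close>, the span of \<open>X B\<close>, and hence is itself an element of the module. To see this, fix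
vectors \<open>g\<^sub>1, \<dots>, g\<^sub>n\<close> and project \<open>(S g\<^sub>i)\<close> orthogonally onto the closure of \<open>{(d \<odot> g\<^sub>i) | d \<in> D}\<close>. If
\<open>r = lim (S g\<^sub>i - d\<^sub>k \<odot> g\<^sub>i)\<close> is the residual, then \<open>L\<^sub>x L\<^sub>x\<^sup>* r\<close> is the limit of the tuples of
\<open>x (L\<^sub>x\<^sup>* S - \<langle>x, d\<^sub>k\<rangle>) \<in> D\<close>. So it is orthogonal to \<open>r\<close>, whence \<open>L\<^sub>x\<^sup>* r = 0\<close> for all \<open>x \<in> X\<close>; as \<open>r\<close>
lies in \<open>M\<close>, it vanishes.\<close>

lemma operator_eq_tens_if_coefficients_in_algebra:
  assumes S: "clinear S" and S_bound: "\<And>g. norm (S g) \<le> K * norm g"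
    and S_range: "\<And>g. S g \<in> closure (cspan {tens x g | x g. x \<in> X})"
    and coeff: "\<And>x. x \<in> X \<Longrightarrow> \<exists>b\<in>B. \<forall>g g'. cinner (tens x g) (S g') = cinner g (bop_apply b g')"
  shows "\<exists>z. \<forall>g. S g = tens z g"
proof -
  define D where "D = cspan {ract x b | x b. x \<in> X \<and> b \<in> B}"
  have D_sub: "csubspace D"
    by (simp add: D_def csubspace_cspan)
  have D_ract: "ract x b \<in> D" if "x \<in> X" "b \<in> B" for x b
    unfolding D_def using that by (intro cspan_base) blast
  define M where "M = closure (cspan {tens x g | x g. x \<in> X})"
  have M_sub: "csubspace M"
    by (simp add: M_def csubspace_closure csubspace_cspan)
  have tens_M: "tens x g \<in> M" if "x \<in> X" for x g
    unfolding M_def using that by (intro subsetD[OF closure_subset] cspan_base) blast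
  have D_M: "tens d g \<in> M" if "d \<in> D" for d g
  proof -
    have "csubspace {d. tens d g \<in> M}"
      unfolding csubspace_def
      by (rule complex_vector.subspaceI)
        (simp_all add: clinear_zero[OF tens_clinear_left] clinear_add[OF tens_clinear_left]
          clinear_scaleC[OF tens_clinear_left] csubspace_0 csubspace_add csubspace_scaleC M_sub)
    then have "D \<subseteq> {d. tens d g \<in> M}"
      unfolding D_def by (intro cspan_minimal) (auto simp: tens_ract tens_M)
    with that show ?thesis
      by blast
  qed
  have approx: "\<exists>d\<in>D. \<forall>i<n. norm (S (g i) - tens d (g i)) < e" if "0 < e" for e and n :: nat and g
  proof -
    define \<Gamma> where "\<Gamma> = {(\<lambda>i. tens d (g i), \<Sum>i<n. cinner (S (g i)) (tens d (g i))) | d. d \<in> D}"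
    have ne: "\<Gamma> \<noteq> {}"
      using csubspace_0[OF D_sub] by (auto simp: \<Gamma>_def)
    have add: "(\<lambda>i. u i + v i, c + d) \<in> \<Gamma>" if uv: "(u, c) \<in> \<Gamma>" "(v, d) \<in> \<Gamma>" for u c v d
    proof -
      obtain x y where "x \<in> D" "y \<in> D" "u = (\<lambda>i. tens x (g i))" "v = (\<lambda>i. tens y (g i))"
        "c = (\<Sum>i<n. cinner (S (g i)) (tens x (g i)))" "d = (\<Sum>i<n. cinner (S (g i)) (tens y (g i)))"
        using uv by (auto simp: \<Gamma>_def)
      then show ?thesis
        unfolding \<Gamma>_def
        by (auto simp: clinear_add[OF tens_clinear_left] cinner_add_right sum.distrib
            intro!: exI[of _ "x + y"] csubspace_add[OF D_sub])
    qed
    have scale: "(\<lambda>i. t *\<^sub>C u i, t * c) \<in> \<Gamma>" if uc: "(u, c) \<in> \<Gamma>" for t u c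
    proof -
      obtain x where "x \<in> D" "u = (\<lambda>i. tens x (g i))"
        "c = (\<Sum>i<n. cinner (S (g i)) (tens x (g i)))"
        using uc by (auto simp: \<Gamma>_def)
      then show ?thesis
        unfolding \<Gamma>_def
        by (auto simp: clinear_scaleC[OF tens_clinear_left] cinner_scaleC_right sum_distrib_left
            intro!: exI[of _ "t *\<^sub>C x"] csubspace_scaleC[OF D_sub])
    qed
    have bd: "cmod c \<le> sqrt (\<Sum>i<n. (norm (S (g i)))\<^sup>2) * sqrt (\<Sum>i<n. (norm (u i))\<^sup>2)"
      if "(u, c) \<in> \<Gamma>" for u c
    proof -
      have c: "c = (\<Sum>i<n. cinner (S (g i)) (u i))"
        using that by (auto simp: \<Gamma>_def)
      have "cmod c \<le> (\<Sum>i<n. cmod (cinner (S (g i)) (u i)))"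
        unfolding c by (rule norm_sum)
      also have "\<dots> \<le> (\<Sum>i<n. \<bar>norm (S (g i))\<bar> * \<bar>norm (u i)\<bar>)"
        by (intro sum_mono) (simp add: cinner_Cauchy_Schwarz)
      also have "\<dots> \<le> L2_set (\<lambda>i. norm (S (g i))) {..<n} * L2_set (\<lambda>i. norm (u i)) {..<n}"
        by (rule L2_set_mult_ineq)
      finally show ?thesis
        by (simp add: L2_set_def)
    qed
    have "\<exists>p U. (\<forall>u c. (u, c) \<in> \<Gamma> \<longrightarrow> c = (\<Sum>i<n. cinner (p i) (u i))) \<and>
        (\<forall>k::nat. U k \<in> Domain \<Gamma>) \<and> (\<forall>i<n. (\<lambda>k. U k i) \<longlonglongrightarrow> p i)"
      by (rule linear_relation_representation[OF ne add scale bd])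
    then obtain p and U :: "nat \<Rightarrow> nat \<Rightarrow> 'h" where p: "\<forall>u c. (u, c) \<in> \<Gamma> \<longrightarrow> c = (\<Sum>i<n. cinner (p i) (u i))"
      and U: "\<forall>k. U k \<in> Domain \<Gamma>" and lim: "\<forall>i<n. (\<lambda>k. U k i) \<longlonglongrightarrow> p i"
      by (elim exE conjE)
    have "\<exists>d. d \<in> D \<and> U k = (\<lambda>i. tens d (g i))" for k
      using U[rule_format, of k] by (auto simp: \<Gamma>_def)
    then obtain d where d: "\<And>k. d k \<in> D" "\<And>k. U k = (\<lambda>i. tens (d k) (g i))"
      by metis
    define r where "r i = S (g i) - p i" for i
    have r_lim: "(\<lambda>k. S (g i) - tens (d k) (g i)) \<longlonglongrightarrow> r i" if "i < n" for i
      using lim that by (auto simp: r_def d(2) intro!: tendsto_diff)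
    have r_orth: "(\<Sum>i<n. cinner (r i) (tens x (g i))) = 0" if "x \<in> D" for x
    proof -
      have "(\<Sum>i<n. cinner (S (g i)) (tens x (g i))) = (\<Sum>i<n. cinner (p i) (tens x (g i)))"
        using that by (intro p[rule_format]) (auto simp: \<Gamma>_def)
      then show ?thesis
        by (simp add: r_def cinner_diff_left sum_subtractf)
    qed
    have r_zero: "cinner (tens x h) (r i) = 0" if x: "x \<in> X" and i: "i < n" for x h i
    proof -
      obtain b where b: "b \<in> B" "\<And>g g'. cinner (tens x g) (S g') = cinner g (bop_apply b g')"
        using coeff[OF x] by blast
      obtain L where L: "clinear L" "\<And>g y. cinner (tens x g) y = cinner g (L y)"
        "\<And>y. norm (L y) \<le> norm x * norm y"
        using clinear_adjoint_exists[OF tens_clinear norm_ge_zero norm_tens_le] by metis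
      \<comment> \<open>\<open>L\<close> is the adjoint of \<open>L\<^sub>x\<close>.\<close>
      have L_S: "L (S h) = bop_apply b h" for h
        by (rule cinner_ext) (metis L(2) b(2) cinner_commute)
      have L_tens: "L (tens y h) = bop_apply (ip x y) h" for y h
        by (rule cinner_ext) (metis L(2) tens_inner cinner_commute)
      have lim_L: "(\<lambda>k. tens x (L (S (g j) - tens (d k) (g j)))) \<longlonglongrightarrow> tens x (L (r j))" if "j < n" for j
        by (intro bounded_linear.tendsto[OF bounded_linear_tens]
            bounded_linear.tendsto[OF clinear_bounded_linear[OF L(1,3)]] r_lim that)
      have "(\<Sum>j<n. cinner (r j) (tens x (L (S (g j) - tens (d k) (g j))))) = 0" for k
      proof -
        have "ract x (b - ip x (d k)) \<in> D"
          using x b(1) by (intro D_ract csubspace_diff[OF B_subspace] ip_in)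
        from r_orth[OF this] show ?thesis
          using b(1) by (simp add: tens_ract csubspace_diff[OF B_subspace] ip_in bop_apply_diff
              clinear_diff[OF L(1)] L_S L_tens)
      qed
      moreover have "(\<lambda>k. \<Sum>j<n. cinner (r j) (tens x (L (S (g j) - tens (d k) (g j)))))
          \<longlonglongrightarrow> (\<Sum>j<n. cinner (r j) (tens x (L (r j))))"
        by (intro tendsto_sum tendsto_cinner tendsto_const lim_L) simp
      ultimately have "(\<Sum>j<n. cinner (r j) (tens x (L (r j)))) = 0"
        by (simp add: LIMSEQ_const_iff)
      moreover have "cinner (r j) (tens x (L (r j))) = complex_of_real ((norm (L (r j)))\<^sup>2)" for j
        by (metis L(2) cinner_commute cinner_self)
      ultimately have "complex_of_real (\<Sum>j<n. (norm (L (r j)))\<^sup>2) = 0"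
        by simp
      then have "(\<Sum>j<n. (norm (L (r j)))\<^sup>2) = 0"
        by (simp only: of_real_eq_0_iff)
      then have "L (r i) = 0"
        using i by (simp add: sum_nonneg_eq_0_iff)
      then show ?thesis
        by (simp add: L(2))
    qed
    have "r i = 0" if i: "i < n" for i
    proof (rule orthogonal_closure_cspan_eq_0[where X = "{tens x g | x g. x \<in> X}"])
      have "closed M"
        by (simp add: M_def)
      then have "p i \<in> M"
        using lim i D_M d by (auto intro: closed_sequentially[of M "\<lambda>k. U k i"])
      then have "r i \<in> M"
        unfolding r_def using S_range by (intro csubspace_diff[OF M_sub]) (auto simp: M_def)
      then show "r i \<in> closure (cspan {tens x g | x g. x \<in> X})"
        by (simp add: M_def)
    qed (use r_zero i in auto)
    then have "\<forall>\<^sub>F k in sequentially. norm (S (g i) - tens (d k) (g i)) < e" if "i < n" for i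
      using r_lim[OF that] that \<open>0 < e\<close> by (auto simp: tendsto_iff)
    then have "\<forall>\<^sub>F k in sequentially. \<forall>i\<in>{..<n}. norm (S (g i) - tens (d k) (g i)) < e"
      by (intro eventually_ball_finite) auto
    then obtain k where "\<forall>i\<in>{..<n}. norm (S (g i) - tens (d k) (g i)) < e"
      by (auto simp: eventually_sequentially)
    then show ?thesis
      using d(1) by blast
  qed
  have S_apply: "blinfun_apply (Blinfun S) g = S g" for g
    by (simp add: bounded_linear_Blinfun_apply clinear_bounded_linear[OF S S_bound])
  have tens_apply: "blinfun_apply (Blinfun (tens x)) g = tens x g" for x g
    by (simp add: bounded_linear_Blinfun_apply bounded_linear_tens)
  have "Blinfun S \<in> range (\<lambda>x. Blinfun (tens x))"
  proof (rule strong_operator_closed_approx[OF tens_closed])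
    fix F :: "'g set" and e :: real
    assume "finite F" "0 < e"
    obtain n and g :: "nat \<Rightarrow> 'g" where F: "F = g ` {i. i < n}"
      using finite_imp_nat_seg_image_inj_on[OF \<open>finite F\<close>] by blast
    obtain d where "\<forall>i<n. norm (S (g i) - tens d (g i)) < e"
      using approx[OF \<open>0 < e\<close>] by blast
    then show "\<exists>T\<in>range (\<lambda>x. Blinfun (tens x)). \<forall>x\<in>F. norm (blinfun_apply (Blinfun S) x - blinfun_apply T x) < e"
      by (auto simp: F S_apply tens_apply)
  qed
  then obtain z where "Blinfun S = Blinfun (tens z)"
    by blast
  then show ?thesis
    by (metis S_apply tens_apply)
qed

end

section \<open>Left actions on von Neumann modules\<close>

lemma star_one: "star 1 = (1 :: 'a::{star,complex_star_algebra,monoid_mult})"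
  by (metis mult_1_left mult_1_right star_mult star_star)

lemma star_zero: "star 0 = (0 :: 'a::complex_star_algebra)"
  using star_add[of 0 "0 :: 'a"] by simp

locale vn_bimodule = vn_module B ip ract tens + hilbert_bimodule B ip ract lact
  for B :: "'g::chilbert_space bop set"
    and ip :: "'e::complex_banach \<Rightarrow> 'e \<Rightarrow> 'g bop"
    and ract :: "'e \<Rightarrow> 'g bop \<Rightarrow> 'e"
    and tens :: "'e \<Rightarrow> 'g \<Rightarrow> 'h::chilbert_space"
    and lact :: "'a::unital_cstar_algebra \<Rightarrow> 'e \<Rightarrow> 'e"
begin

lemma ip_eqI:
  assumes "\<And>z. ip z x = ip z y"
  shows "x = y"
  by (rule tens_eqI, rule tens_total_eqI) (simp add: tens_inner assms)

lemma lact_star': "ip x (lact a y) = ip (lact (star a) x) y"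
  by (simp add: lact_star star_star)

lemma lact_clinear_right: "clinear (lact a)"
  unfolding clinear_iff
  by (intro conjI allI; rule ip_eqI)
    (simp_all add: lact_star' clinear_add[OF ip_clinear] clinear_scaleC[OF ip_clinear])

lemma eq_0_if_tens_self_orthogonal:
  assumes "\<And>g. cinner (tens x g) (tens x g) = 0"
  shows "x = 0"
  by (rule tens_eqI) (use assms in \<open>simp add: cinner_self_eq_0 clinear_zero[OF tens_clinear_left]\<close>)

text \<open>By nondegeneracy: \<open>x - 1x\<close> is orthogonal to every \<open>az\<close>, and these span a dense subspace.\<close>

lemma lact_one: "lact 1 x = x"
proof -
  define w where "w = x - lact 1 x"
  have "cinner (tens w g) (tens w g') = 0" for g g'
  proof -
    let ?N = "{v. cinner (tens v g) (tens w g') = 0}"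
    have "csubspace ?N"
      unfolding csubspace_def
      by (rule complex_vector.subspaceI)
        (simp_all add: clinear_zero[OF tens_clinear_left] clinear_add[OF tens_clinear_left]
          clinear_scaleC[OF tens_clinear_left] cinner_add_left cinner_scaleC_left)
    moreover have "lact a z \<in> ?N" for a z
    proof -
      have "ip (lact a z) w = 0"
        by (simp add: w_def lact_star clinear_diff[OF lact_clinear_right] clinear_zero[OF ip_clinear] flip: lact_mult)
      then show ?thesis
        by (simp add: tens_inner bop_apply_zero_left)
    qed
    ultimately have "cspan {lact a z | a z. True} \<subseteq> ?N"
      by (intro cspan_minimal) auto
    moreover have "closed ?N"
    proof -
      have "bounded_linear (\<lambda>v. tens v g)"
        by (rule clinear_bounded_linear[OF tens_clinear_left, of _ "norm g"])
          (simp add: norm_tens_le mult.commute)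
      then have "continuous_on UNIV (\<lambda>v. cinner (tens v g) (tens w g'))"
        by (intro bounded_linear.continuous_on[OF bounded_bilinear.bounded_linear_left[OF bounded_bilinear_cinner]]
            linear_continuous_on)
      then show ?thesis
        by (intro closed_Collect_eq continuous_on_const)
    qed
    ultimately have "closure (cspan {lact a z | a z. True}) \<subseteq> ?N"
      by (rule closure_minimal)
    then show ?thesis
      unfolding lact_nondegenerate by blast
  qed
  then have "w = 0"
    by (rule eq_0_if_tens_self_orthogonal)
  then show ?thesis
    by (simp add: w_def)
qed

text \<open>If \<open>X\<close> is invariant under \<open>a\<close>, so is the set of module elements with range in the closed span of
\<open>X \<odot> \<G>\<close>. A continuity argument would require a norm bound for the left action; the following one is
algebraic. The orthogonal projection onto that span maps \<open>at\<close> to a module element \<open>q\<close> (more precisely, \<open>L\<^bsub>at\<^esub>\<close> to \<open>L\<^sub>q\<close>), and \<open>w = at - q\<close> is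
orthogonal to \<open>X\<close>. Then so is \<open>a\<^sup>* w\<close>, hence \<open>\<langle>w, at\<rangle> = \<langle>a\<^sup>* w, t\<rangle> = 0\<close>, and \<open>\<langle>w, w\<rangle> = 0\<close>.\<close>

lemma lact_invariant_range:
  assumes X: "\<And>x. x \<in> X \<Longrightarrow> lact a x \<in> X"
    and t: "\<And>g. tens t g \<in> closure (cspan {tens x g | x g. x \<in> X})"
  shows "tens (lact a t) g \<in> closure (cspan {tens x g | x g. x \<in> X})"
proof -
  let ?Y = "{tens x g | x g. x \<in> X}"
  obtain P where P: "clinear P" "\<And>h. norm (P h) \<le> norm h" "\<And>h. P h \<in> closure (cspan ?Y)"
    "\<And>y h. y \<in> ?Y \<Longrightarrow> cinner y (P h) = cinner y h"
    by (rule orthogonal_projection_operator[of ?Y]) blast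
  have "\<exists>q. \<forall>g. P (tens (lact a t) g) = tens q g"
  proof (rule operator_eq_tens_if_coefficients_in_algebra[of "\<lambda>g. P (tens (lact a t) g)" "norm (lact a t)" X])
    show "clinear (\<lambda>g. P (tens (lact a t) g))"
      using P(1) tens_clinear[of "lact a t"] by (simp add: clinear_iff)
    show "norm (P (tens (lact a t) g)) \<le> norm (lact a t) * norm g" for g
      using P(2) norm_tens_le order_trans by blast
    show "P (tens (lact a t) g) \<in> closure (cspan ?Y)" for g
      by (rule P(3))
    show "\<exists>b\<in>B. \<forall>g g'. cinner (tens x g) (P (tens (lact a t) g')) = cinner g (bop_apply b g')"
      if "x \<in> X" for x
    proof (intro bexI allI)
      show "cinner (tens x g) (P (tens (lact a t) g')) = cinner g (bop_apply (ip x (lact a t)) g')" for g g'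
        using that by (subst P(4)) (auto simp: tens_inner)
    qed (rule ip_in)
  qed
  then obtain q where q: "\<And>g. P (tens (lact a t) g) = tens q g"
    by blast
  define w where "w = lact a t - q"
  have ip_w: "ip x w = 0" if "x \<in> X" for x
  proof (rule bop_eqI_cinner)
    fix g g'
    have "cinner (tens x g) (tens q g') = cinner (tens x g) (tens (lact a t) g')"
      unfolding q[symmetric] using that by (intro P(4)) auto
    then show "cinner g (bop_apply (ip x w) g') = cinner g (bop_apply 0 g')"
      by (simp add: w_def flip: tens_inner) 
        (simp add: clinear_diff[OF tens_clinear_left] cinner_diff_right bop_apply_zero_left)
  qed
  have orth: "cinner (tens u g) y = 0"
    if u: "\<And>x. x \<in> X \<Longrightarrow> ip x u = 0" and y: "y \<in> closure (cspan ?Y)" for u g y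
  proof (rule orthogonal_closure_cspan[OF _ y])
    show "cinner (tens u g) z = 0" if zY: "z \<in> ?Y" for z
    proof -
      obtain x g' where x: "x \<in> X" "z = tens x g'"
        using zY by blast
      have "ip u x = star (ip x u)"
        by (simp add: ip_star)
      then show ?thesis
        using u[OF x(1)] by (simp add: x(2) tens_inner cinner_bop_star bop_apply_zero_left)
    qed
  qed
  have "ip x (lact (star a) w) = 0" if "x \<in> X" for x
    using ip_w[OF X[OF that]] by (simp add: lact_star' star_star)
  then have "cinner (tens (lact (star a) w) g) (tens t g') = 0" for g g'
    using orth t by blast
  then have 1: "cinner (tens w g) (tens (lact a t) g') = 0" for g g'
    by (simp add: tens_inner lact_star')
  have 2: "cinner (tens w g) (tens q g') = 0" for g g'
    using orth[OF ip_w P(3)] by (metis q)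
  have "cinner (tens w g) (tens w g) = 0" for g
  proof -
    have "tens (lact a t) g - tens q g = tens w g"
      by (simp add: w_def clinear_diff[OF tens_clinear_left])
    moreover have "cinner (tens w g) (tens (lact a t) g - tens q g) = 0"
      by (simp only: cinner_diff_right 1 2) simp
    ultimately show ?thesis
      by simp
  qed
  then have "w = 0"
    by (rule eq_0_if_tens_self_orthogonal)
  then have "q = lact a t"
    by (simp add: w_def)
  then show ?thesis
    using P(3)[of "tens (lact a t) g"] unfolding q[of g] by simp
qed

end

section \<open>The kernel of a completely positive block map\<close>

lemma mat2_sum_entries:
  "m11 (sum f I) = (\<Sum>i\<in>I. m11 (f i))" "m12 (sum f I) = (\<Sum>i\<in>I. m12 (f i))"
  "m21 (sum f I) = (\<Sum>i\<in>I. m21 (f i))" "m22 (sum f I) = (\<Sum>i\<in>I. m22 (f i))"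
  by (induction I rule: infinite_finite_induct) (simp_all add: mat2_defs)

lemma bop_apply_zero: "bop_apply T 0 = 0"
  by (rule clinear_zero) (simp add: clinear_iff bop_apply_add bop_apply_scaleC)

lemma bop_apply_sum_left: "bop_apply (\<Sum>i\<in>I. f i) x = (\<Sum>i\<in>I. bop_apply (f i) x)"
  by (induction I rule: infinite_finite_induct)
    (simp_all add: bop_apply_plus bop_apply_zero_left)

lemma cinner_sum_sum:
  "cinner (\<Sum>i\<in>I. f i) (\<Sum>i\<in>I. f i) = (\<Sum>i\<in>I. \<Sum>j\<in>I. cinner (f i) (f j :: 'a::complex_inner))"
  by (simp only: cinner_sum_left cinner_sum_right) (rule sum.swap)

text \<open>Apply complete positivity to the matrix \<open>Y\<^sup>* Y\<close>, where \<open>Y\<close> has the single nonzero row of \<open>2 \<times> 2\<close> blocks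
with first rows \<open>(a\<^sub>i, a'\<^sub>i)\<close> and second rows zero, and evaluate the resulting positive matrix at the
vectors \<open>(g\<^sub>i, g'\<^sub>i)\<close>. The two off-diagonal contributions are complex conjugates of each other.\<close>

lemma completely_positive_block_form_nonneg:
  fixes \<phi>\<^sub>1 \<phi>\<^sub>2 \<psi> :: "'a::unital_cstar_algebra \<Rightarrow> 'g::chilbert_space bop"
    and a a' :: "nat \<Rightarrow> 'a" and g g' :: "nat \<Rightarrow> 'g" and n :: nat
  assumes cp: "completely_positive (mat2_over B) (block_map \<phi>\<^sub>1 \<psi> \<phi>\<^sub>2)"
  defines "P \<equiv> (\<Sum>i<n. \<Sum>j<n. cinner (g i) (bop_apply (\<phi>\<^sub>1 (star (a i) * a j)) (g j)))"
    and "R \<equiv> (\<Sum>i<n. \<Sum>j<n. cinner (g i) (bop_apply (\<psi> (star (a i) * a' j)) (g' j)))"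
    and "Q \<equiv> (\<Sum>i<n. \<Sum>j<n. cinner (g' i) (bop_apply (\<phi>\<^sub>2 (star (a' i) * a' j)) (g' j)))"
  shows "0 \<le> Re P + 2 * Re R + Re Q"
proof -
  define X where "X i j = Mat2 (star (a i) * a j) (star (a i) * a' j) (star (a' i) * a j) (star (a' i) * a' j)" for i j
  have "mat_positive UNIV n X"
  proof (cases n)
    case (Suc m)
    define Y where "Y k j = (if k = 0 then Mat2 (a j) (a' j) 0 0 else 0)" for k j :: nat
    have "star (Y k i) * Y k j = (if k = 0 then X i j else 0)" for k i j
    proof (cases "k = 0")
      case True
      then show ?thesis
        by (simp add: Y_def X_def times_mat2_def star_mat2_def star_zero)
    next
      case False
      then show ?thesis
        by (simp add: Y_def)
    qed
    then have "X i j = (\<Sum>k<n. star (Y k i) * Y k j)" for i j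
      using Suc by (simp add: sum.delta)
    then show ?thesis
      unfolding mat_positive_def by (intro exI[of _ Y]) simp
  qed (simp add: mat_positive_def)
  then have "mat_positive (mat2_over B) n (\<lambda>i j. block_map \<phi>\<^sub>1 \<psi> \<phi>\<^sub>2 (X i j))"
    using cp by (simp add: completely_positive_def)
  then obtain Z where Z': "\<forall>i<n. \<forall>j<n. block_map \<phi>\<^sub>1 \<psi> \<phi>\<^sub>2 (X i j) = (\<Sum>k<n. star (Z k i) * Z k j)"
    unfolding mat_positive_def by (elim exE conjE)
  have Z: "block_map \<phi>\<^sub>1 \<psi> \<phi>\<^sub>2 (X i j) = (\<Sum>k<n. star (Z k i) * Z k j)" if "i < n" "j < n" for i j
    using Z' that by simp
  define p where "p k i = bop_apply (m11 (Z k i)) (g i) + bop_apply (m12 (Z k i)) (g' i)" for k i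
  define q where "q k i = bop_apply (m21 (Z k i)) (g i) + bop_apply (m22 (Z k i)) (g' i)" for k i
  have entry: "cinner (g i) (bop_apply (\<phi>\<^sub>1 (star (a i) * a j)) (g j))
      + cinner (g i) (bop_apply (\<psi> (star (a i) * a' j)) (g' j))
      + cinner (g' i) (bop_apply (star (\<psi> (star (a j) * a' i))) (g j))
      + cinner (g' i) (bop_apply (\<phi>\<^sub>2 (star (a' i) * a' j)) (g' j))
      = (\<Sum>k<n. cinner (p k i) (p k j) + cinner (q k i) (q k j))"
    if ij: "i < n" "j < n" for i j
  proof -
    have "\<phi>\<^sub>1 (star (a i) * a j) = m11 (block_map \<phi>\<^sub>1 \<psi> \<phi>\<^sub>2 (X i j))"
      "\<psi> (star (a i) * a' j) = m12 (block_map \<phi>\<^sub>1 \<psi> \<phi>\<^sub>2 (X i j))"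
      "star (\<psi> (star (a j) * a' i)) = m21 (block_map \<phi>\<^sub>1 \<psi> \<phi>\<^sub>2 (X i j))"
      "\<phi>\<^sub>2 (star (a' i) * a' j) = m22 (block_map \<phi>\<^sub>1 \<psi> \<phi>\<^sub>2 (X i j))"
      by (simp_all add: block_map_def X_def star_map_def star_mult star_star)
    then show ?thesis
      by (simp add: Z[OF ij] mat2_sum_entries bop_apply_sum_left cinner_sum_right p_def q_def
          times_mat2_def star_mat2_def bop_apply_plus bop_apply_times cinner_add_left cinner_add_right
          cinner_bop_star sum.distrib add_ac)
  qed
  have swap: "(\<Sum>i<n. \<Sum>j<n. cinner (g' i) (bop_apply (star (\<psi> (star (a j) * a' i))) (g j))) = cnj R"
    unfolding R_def cnj_sum
    by (subst sum.swap) (simp add: cinner_bop_star flip: cinner_commute)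
  have "P + R + cnj R + Q = P + R
      + (\<Sum>i<n. \<Sum>j<n. cinner (g' i) (bop_apply (star (\<psi> (star (a j) * a' i))) (g j))) + Q"
    by (simp only: swap)
  also have "\<dots> = (\<Sum>i<n. \<Sum>j<n. cinner (g i) (bop_apply (\<phi>\<^sub>1 (star (a i) * a j)) (g j))
      + cinner (g i) (bop_apply (\<psi> (star (a i) * a' j)) (g' j))
      + cinner (g' i) (bop_apply (star (\<psi> (star (a j) * a' i))) (g j))
      + cinner (g' i) (bop_apply (\<phi>\<^sub>2 (star (a' i) * a' j)) (g' j)))"
    unfolding P_def R_def Q_def by (simp only: sum.distrib)
  also have "\<dots> = (\<Sum>i<n. \<Sum>j<n. \<Sum>k<n. cinner (p k i) (p k j) + cinner (q k i) (q k j))"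
    by (intro sum.cong refl entry) auto
  also have "\<dots> = (\<Sum>k<n. \<Sum>i<n. \<Sum>j<n. cinner (p k i) (p k j) + cinner (q k i) (q k j))"
    by (subst (2) sum.swap, subst sum.swap) simp
  also have "\<dots> = (\<Sum>k<n. cinner (\<Sum>i<n. p k i) (\<Sum>i<n. p k i) + cinner (\<Sum>i<n. q k i) (\<Sum>i<n. q k i))"
    by (simp only: cinner_sum_sum sum.distrib)
  finally have "Re (P + R + cnj R + Q) = (\<Sum>k<n. (norm (\<Sum>i<n. p k i))\<^sup>2 + (norm (\<Sum>i<n. q k i))\<^sup>2)"
    by (simp add: cinner_self)
  then have "0 \<le> Re (P + R + cnj R + Q)"
    by (simp add: sum_nonneg)
  then show ?thesis
    by simp
qed

text \<open>The discriminant argument for Cauchy-Schwarz, with \<open>t\<close> a real multiple of \<open>- c\<close>.\<close>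

lemma cmod_le_if_quadratic_form_nonneg:
  fixes c :: complex and p q :: real
  assumes nonneg: "\<And>t. 0 \<le> (cmod t)\<^sup>2 * p\<^sup>2 + 2 * Re (cnj t * c) + q\<^sup>2" and "0 \<le> p" "0 \<le> q"
  shows "cmod c \<le> p * q"
proof (cases "c = 0")
  case True
  then show ?thesis
    using assms by simp
next
  case False
  have s: "0 \<le> s\<^sup>2 * (cmod c)\<^sup>2 * p\<^sup>2 - 2 * s * (cmod c)\<^sup>2 + q\<^sup>2" for s
    using nonneg[of "- of_real s * c"]
    by (simp add: norm_mult power_mult_distrib mult.assoc complex_mult_cnj cmod_power2
        mult.commute[of "cnj c"])
  show ?thesis
  proof (cases "p = 0")
    case True
    define t where "t = (q\<^sup>2 + 1) / (cmod c)\<^sup>2"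
    have "t * (cmod c)\<^sup>2 = q\<^sup>2 + 1"
      using False by (simp add: t_def)
    then have "0 \<le> q\<^sup>2 - 2 * (q\<^sup>2 + 1)"
      using s[of t] True by (simp add: mult.assoc)
    then have "q\<^sup>2 \<le> - 2"
      by simp
    then show ?thesis
      using zero_le_power2[of q] by linarith
  next
    case False
    then have "(1 / p\<^sup>2)\<^sup>2 * (cmod c)\<^sup>2 * p\<^sup>2 = (cmod c)\<^sup>2 / p\<^sup>2"
      by (simp add: power2_eq_square)
    then have "(cmod c)\<^sup>2 / p\<^sup>2 \<le> q\<^sup>2"
      using s[of "1 / p\<^sup>2"] by simp
    then have "(cmod c)\<^sup>2 \<le> (p * q)\<^sup>2"
      using False by (simp add: pos_divide_le_eq power_mult_distrib mult.commute)
    then show ?thesis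
      by (rule power2_le_imp_le) (use assms(2,3) in simp)
  qed
qed

lemma gns_cinner:
  assumes "vn_bimodule B ip ract tens lact" "gns_representation B ip ract lact y \<phi>"
  shows "cinner (tens (lact a y) g) (tens (lact a' y) g') = cinner g (bop_apply (\<phi> (star a * a')) g')"
proof -
  interpret vn_bimodule B ip ract tens lact
    by fact
  show ?thesis
    using assms(2) by (simp add: gns_representation_def tens_inner lact_star lact_mult)
qed

lemma gns_norm_sq:
  assumes "vn_bimodule B ip ract tens lact" "gns_representation B ip ract lact y \<phi>"
  shows "Re (\<Sum>i<n. \<Sum>j<n. cinner (g i) (bop_apply (\<phi> (star (a i) * a j)) (g j)))
    = (norm (\<Sum>i<n. tens (lact (a i) y) (g i)))\<^sup>2"
proof -
  let ?u = "\<Sum>i<n. tens (lact (a i) y) (g i)"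
  have "complex_of_real ((norm ?u)\<^sup>2) = cinner ?u ?u"
    by (simp only: cinner_self)
  also have "\<dots> = (\<Sum>i<n. \<Sum>j<n. cinner (g i) (bop_apply (\<phi> (star (a i) * a j)) (g j)))"
    by (simp only: cinner_sum_sum gns_cinner[OF assms])
  finally show ?thesis
    by (metis Re_complex_of_real)
qed

text \<open>Cauchy-Schwarz for the positive form of the block map: by the GNS representations its diagonal parts
are the squared norms of vectors in \<open>F\<^sub>1 \<odot> \<G>\<close> and \<open>F\<^sub>2 \<odot> \<G>\<close>.\<close>

lemma completely_positive_block_kernel_bound:
  fixes \<phi>\<^sub>1 \<phi>\<^sub>2 \<psi> :: "'a::unital_cstar_algebra \<Rightarrow> 'g::chilbert_space bop"
    and a a' :: "nat \<Rightarrow> 'a" and g g' :: "nat \<Rightarrow> 'g" and n m :: nat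
  assumes cp: "completely_positive (mat2_over B) (block_map \<phi>\<^sub>1 \<psi> \<phi>\<^sub>2)"
    and 1: "vn_bimodule B ip\<^sub>1 ract\<^sub>1 tens\<^sub>1 lact\<^sub>1" "gns_representation B ip\<^sub>1 ract\<^sub>1 lact\<^sub>1 y\<^sub>1 \<phi>\<^sub>1"
    and 2: "vn_bimodule B ip\<^sub>2 ract\<^sub>2 tens\<^sub>2 lact\<^sub>2" "gns_representation B ip\<^sub>2 ract\<^sub>2 lact\<^sub>2 y\<^sub>2 \<phi>\<^sub>2"
  shows "cmod (\<Sum>i<n. \<Sum>j<m. cinner (g i) (bop_apply (\<psi> (star (a i) * a' j)) (g' j)))
    \<le> norm (\<Sum>i<n. tens\<^sub>1 (lact\<^sub>1 (a i) y\<^sub>1) (g i)) * norm (\<Sum>j<m. tens\<^sub>2 (lact\<^sub>2 (a' j) y\<^sub>2) (g' j))"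
    (is "cmod ?c \<le> norm ?u * norm ?v")
proof (rule cmod_le_if_quadratic_form_nonneg)
  interpret M1: vn_bimodule B ip\<^sub>1 ract\<^sub>1 tens\<^sub>1 lact\<^sub>1 by fact
  interpret M2: vn_bimodule B ip\<^sub>2 ract\<^sub>2 tens\<^sub>2 lact\<^sub>2 by fact
  fix t :: complex
  \<comment> \<open>Pad both families with zero vectors to a common length and scale the first one by \<open>t\<close>.\<close>
  define N where "N = max n m"
  have N: "n \<le> N" "m \<le> N"
    by (simp_all add: N_def)
  define h where "h i = (if i < n then t *\<^sub>C g i else 0)" for i
  define h' where "h' j = (if j < m then g' j else 0)" for j
  have cut: "(\<Sum>i<N. if i < k then f i else 0) = (\<Sum>i<k. f i)" if "k \<le> N"
    for f :: "nat \<Rightarrow> 'z::comm_monoid_add" and k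
  proof -
    have "(\<Sum>i<N. if i < k then f i else 0) = (\<Sum>i\<in>{i\<in>{..<N}. i < k}. f i)"
      by (subst sum.inter_filter) auto
    also have "{i\<in>{..<N}. i < k} = {..<k}"
      using that by auto
    finally show ?thesis .
  qed
  have "(\<Sum>i<N. tens\<^sub>1 (lact\<^sub>1 (a i) y\<^sub>1) (h i)) = (\<Sum>i<N. if i < n then t *\<^sub>C tens\<^sub>1 (lact\<^sub>1 (a i) y\<^sub>1) (g i) else 0)"
    by (intro sum.cong) (auto simp: h_def clinear_zero[OF M1.tens_clinear] clinear_scaleC[OF M1.tens_clinear])
  then have u: "(\<Sum>i<N. tens\<^sub>1 (lact\<^sub>1 (a i) y\<^sub>1) (h i)) = t *\<^sub>C ?u"
    by (simp add: cut N complex_vector.scale_sum_right)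
  have "(\<Sum>j<N. tens\<^sub>2 (lact\<^sub>2 (a' j) y\<^sub>2) (h' j)) = (\<Sum>j<N. if j < m then tens\<^sub>2 (lact\<^sub>2 (a' j) y\<^sub>2) (g' j) else 0)"
    by (intro sum.cong) (auto simp: h'_def clinear_zero[OF M2.tens_clinear])
  then have v: "(\<Sum>j<N. tens\<^sub>2 (lact\<^sub>2 (a' j) y\<^sub>2) (h' j)) = ?v"
    by (simp add: cut N)
  have "(\<Sum>i<N. \<Sum>j<N. cinner (h i) (bop_apply (\<psi> (star (a i) * a' j)) (h' j)))
      = (\<Sum>i<N. if i < n then (\<Sum>j<N. if j < m then cnj t * cinner (g i) (bop_apply (\<psi> (star (a i) * a' j)) (g' j)) else 0) else 0)"
    by (intro sum.cong) (auto simp: h_def h'_def bop_apply_zero cinner_scaleC_left intro!: sum.cong)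
  then have c: "(\<Sum>i<N. \<Sum>j<N. cinner (h i) (bop_apply (\<psi> (star (a i) * a' j)) (h' j))) = cnj t * ?c"
    by (simp add: cut N sum_distrib_left)
  show "0 \<le> (cmod t)\<^sup>2 * (norm ?u)\<^sup>2 + 2 * Re (cnj t * ?c) + (norm ?v)\<^sup>2"
    using completely_positive_block_form_nonneg[OF cp, where n = N and a = a and a' = a' and g = h and g' = h']
    unfolding gns_norm_sq[OF 1] gns_norm_sq[OF 2] u v c
    by (simp add: norm_scaleC power_mult_distrib)
qed simp_all

section \<open>The intertwining contraction\<close>

theorem theorem3p7:
  fixes B :: "'g::chilbert_space bop set"
    and \<phi>\<^sub>1 \<phi>\<^sub>2 \<psi> :: "'a::unital_cstar_algebra \<Rightarrow> 'g bop"
    and ip\<^sub>1 :: "'e\<^sub>1::complex_banach \<Rightarrow> 'e\<^sub>1 \<Rightarrow> 'g bop"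
    and ip\<^sub>2 :: "'e\<^sub>2::complex_banach \<Rightarrow> 'e\<^sub>2 \<Rightarrow> 'g bop"
    and ract\<^sub>1 :: "'e\<^sub>1 \<Rightarrow> 'g bop \<Rightarrow> 'e\<^sub>1" and ract\<^sub>2 :: "'e\<^sub>2 \<Rightarrow> 'g bop \<Rightarrow> 'e\<^sub>2"
    and lact\<^sub>1 :: "'a \<Rightarrow> 'e\<^sub>1 \<Rightarrow> 'e\<^sub>1" and lact\<^sub>2 :: "'a \<Rightarrow> 'e\<^sub>2 \<Rightarrow> 'e\<^sub>2"
    and y\<^sub>1 :: 'e\<^sub>1 and y\<^sub>2 :: 'e\<^sub>2
    and tens\<^sub>1 :: "'e\<^sub>1 \<Rightarrow> 'g \<Rightarrow> 'h\<^sub>1::chilbert_space"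
    and tens\<^sub>2 :: "'e\<^sub>2 \<Rightarrow> 'g \<Rightarrow> 'h\<^sub>2::chilbert_space"
  assumes "separable_space (euclidean :: 'g topology)"
    and "von_neumann_algebra B"
    and "completely_positive B \<phi>\<^sub>1" and "completely_positive B \<phi>\<^sub>2"
    and "gns_representation B ip\<^sub>1 ract\<^sub>1 lact\<^sub>1 y\<^sub>1 \<phi>\<^sub>1"
    and "gns_representation B ip\<^sub>2 ract\<^sub>2 lact\<^sub>2 y\<^sub>2 \<phi>\<^sub>2"
    and "von_neumann_module B ip\<^sub>1 ract\<^sub>1 tens\<^sub>1"
    and "von_neumann_module B ip\<^sub>2 ract\<^sub>2 tens\<^sub>2"
    and "completely_bounded B \<psi>"
    and "completely_positive (mat2_over B) (block_map \<phi>\<^sub>1 \<psi> \<phi>\<^sub>2)"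
  shows "\<exists>T :: 'e\<^sub>2 \<Rightarrow> 'e\<^sub>1.
    adjointable ip\<^sub>2 ip\<^sub>1 T \<and> bilinear_map B ract\<^sub>2 lact\<^sub>2 ract\<^sub>1 lact\<^sub>1 T \<and>
    (\<forall>x. norm (T x) \<le> norm x) \<and> (\<forall>a. \<psi> a = ip\<^sub>1 y\<^sub>1 (T (lact\<^sub>2 a y\<^sub>2)))"
proof -
  have vn: "von_neumann_algebra B" by fact
  have gns1: "gns_representation B ip\<^sub>1 ract\<^sub>1 lact\<^sub>1 y\<^sub>1 \<phi>\<^sub>1"
    and gns2: "gns_representation B ip\<^sub>2 ract\<^sub>2 lact\<^sub>2 y\<^sub>2 \<phi>\<^sub>2" by fact+
  have mod1: "von_neumann_module B ip\<^sub>1 ract\<^sub>1 tens\<^sub>1"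
    and mod2: "von_neumann_module B ip\<^sub>2 ract\<^sub>2 tens\<^sub>2" by fact+
  have cp: "completely_positive (mat2_over B) (block_map \<phi>\<^sub>1 \<psi> \<phi>\<^sub>2)" by fact
  have \<psi>_in: "\<psi> a \<in> B" for a
    using \<open>completely_bounded B \<psi>\<close> by (auto simp: completely_bounded_def)
  have bi1: "vn_bimodule B ip\<^sub>1 ract\<^sub>1 tens\<^sub>1 lact\<^sub>1"
    using gns1 mod1 vn
    by (auto simp: vn_bimodule_def vn_module_def vn_module_axioms_def gns_representation_def von_neumann_module_def)
  have bi2: "vn_bimodule B ip\<^sub>2 ract\<^sub>2 tens\<^sub>2 lact\<^sub>2"
    using gns2 mod2 vn
    by (auto simp: vn_bimodule_def vn_module_def vn_module_axioms_def gns_representation_def von_neumann_module_def)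
  interpret M1: vn_bimodule B ip\<^sub>1 ract\<^sub>1 tens\<^sub>1 lact\<^sub>1 by (rule bi1)
  interpret M2: vn_bimodule B ip\<^sub>2 ract\<^sub>2 tens\<^sub>2 lact\<^sub>2 by (rule bi2)
  define e\<^sub>1 where "e\<^sub>1 i = tens\<^sub>1 (lact\<^sub>1 (fst i) y\<^sub>1) (snd i)" for i
  define e\<^sub>2 where "e\<^sub>2 i = tens\<^sub>2 (lact\<^sub>2 (fst i) y\<^sub>2) (snd i)" for i
  define \<beta> where "\<beta> i j = cinner (snd i) (bop_apply (\<psi> (star (fst i) * fst j)) (snd j))" for i j
  have bound: "cmod (\<Sum>(c, i)\<leftarrow>r. \<Sum>(d, j)\<leftarrow>s. cnj c * d * \<beta> i j)
      \<le> norm (\<Sum>(c, i)\<leftarrow>r. c *\<^sub>C e\<^sub>1 i) * norm (\<Sum>(d, j)\<leftarrow>s. d *\<^sub>C e\<^sub>2 j)" for r s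
  proof -
    have nth: "sum_list (map f xs) = (\<Sum>k<length xs. f (xs ! k))"
      for f :: "'x \<Rightarrow> 'y::comm_monoid_add" and xs
      by (simp add: sum_list_sum_nth atLeast0LessThan)
    show ?thesis
      using completely_positive_block_kernel_bound[OF cp bi1 gns1 bi2 gns2,
          where a = "\<lambda>k. fst (snd (r ! k))" and g = "\<lambda>k. fst (r ! k) *\<^sub>C snd (snd (r ! k))" and n = "length r"
          and a' = "\<lambda>k. fst (snd (s ! k))" and g' = "\<lambda>k. fst (s ! k) *\<^sub>C snd (snd (s ! k))" and m = "length s"]
      by (simp add: nth case_prod_beta e\<^sub>1_def e\<^sub>2_def \<beta>_def cinner_scaleC_left cinner_scaleC_right
          bop_apply_scaleC clinear_scaleC[OF M1.tens_clinear] clinear_scaleC[OF M2.tens_clinear] mult_ac)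
  qed
  define X\<^sub>1 where "X\<^sub>1 = range (\<lambda>a. lact\<^sub>1 a y\<^sub>1)"
  define X\<^sub>2 where "X\<^sub>2 = range (\<lambda>a. lact\<^sub>2 a y\<^sub>2)"
  have range1: "range e\<^sub>1 = {tens\<^sub>1 x g | x g. x \<in> X\<^sub>1}"
    by (auto simp: e\<^sub>1_def X\<^sub>1_def image_iff) blast+
  have range2: "range e\<^sub>2 = {tens\<^sub>2 x g | x g. x \<in> X\<^sub>2}"
    by (auto simp: e\<^sub>2_def X\<^sub>2_def image_iff) blast+
  have X1_lact: "lact\<^sub>1 a x \<in> X\<^sub>1" if "x \<in> X\<^sub>1" for a x
    using that unfolding X\<^sub>1_def by (auto simp flip: M1.lact_mult)
  have X2_lact: "lact\<^sub>2 a x \<in> X\<^sub>2" if "x \<in> X\<^sub>2" for a x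
    using that unfolding X\<^sub>2_def by (auto simp flip: M2.lact_mult)
  obtain V :: "'h\<^sub>2 \<Rightarrow> 'h\<^sub>1" and Q :: "'h\<^sub>1 \<Rightarrow> 'h\<^sub>2" where V: "clinear V" "\<And>x. norm (V x) \<le> norm x"
    "\<And>x. V x \<in> closure (cspan {tens\<^sub>1 x g | x g. x \<in> X\<^sub>1})"
    and Q: "clinear Q" "\<And>y. norm (Q y) \<le> norm y"
    "\<And>y. Q y \<in> closure (cspan {tens\<^sub>2 x g | x g. x \<in> X\<^sub>2})"
    and VQ: "\<And>x y. cinner (V x) y = cinner x (Q y)"
    and VB: "\<And>i j. cinner (e\<^sub>1 i) (V (e\<^sub>2 j)) = \<beta> i j"
    by (rule bounded_kernel_contraction[of \<beta> e\<^sub>1 e\<^sub>2, OF bound, unfolded range1 range2]) (rule that)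
  have QV: "cinner (Q y) x = cinner y (V x)" for x y
    by (metis VQ cinner_commute)
  have V_kernel: "cinner (tens\<^sub>1 (lact\<^sub>1 a y\<^sub>1) g) (V (tens\<^sub>2 (lact\<^sub>2 a' y\<^sub>2) g'))
      = cinner g (bop_apply (\<psi> (star a * a')) g')" for a a' g g'
    using VB[of "(a, g)" "(a', g')"] by (simp add: e\<^sub>1_def e\<^sub>2_def \<beta>_def)
  have V_tens_bound: "norm (V (tens\<^sub>2 x g)) \<le> norm x * norm g" for x g
    using V(2) M2.norm_tens_le order_trans by blast
  have Q_tens_bound: "norm (Q (tens\<^sub>1 x g)) \<le> norm x * norm g" for x g
    using Q(2) M1.norm_tens_le order_trans by blast
  have V_tens_clinear: "clinear (\<lambda>g. V (tens\<^sub>2 x g))" for x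
    using V(1) M2.tens_clinear[of x] by (simp add: clinear_iff)
  have Q_tens_clinear: "clinear (\<lambda>g. Q (tens\<^sub>1 x g))" for x
    using Q(1) M1.tens_clinear[of x] by (simp add: clinear_iff)

  \<comment> \<open>On \<open>X\<^sub>1\<close> the coefficients of \<open>Q\<close> are values of \<open>\<psi>\<^sup>*\<close>. This makes the coefficients of \<open>V\<close> with
    respect to \<open>X\<^sub>1\<close> inner products of \<open>F\<^sub>2\<close>, so that \<open>V\<close> restricts to the modules; then so does \<open>Q\<close>.\<close>
  have "\<exists>z. \<forall>g. Q (tens\<^sub>1 x g) = tens\<^sub>2 z g" if x: "x \<in> X\<^sub>1" for x
  proof (rule M2.operator_eq_tens_if_coefficients_in_algebra[OF Q_tens_clinear Q_tens_bound Q(3)])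
    fix x' assume "x' \<in> X\<^sub>2"
    then obtain a a' where a: "x = lact\<^sub>1 a y\<^sub>1" "x' = lact\<^sub>2 a' y\<^sub>2"
      using x by (auto simp: X\<^sub>1_def X\<^sub>2_def)
    have "cinner (tens\<^sub>2 x' g) (Q (tens\<^sub>1 x g')) = cinner g (bop_apply (star (\<psi> (star a * a'))) g')" for g g'
      using V_kernel[of a g' a' g] unfolding a by (metis VQ cinner_bop_star cinner_commute)
    then show "\<exists>b\<in>B. \<forall>g g'. cinner (tens\<^sub>2 x' g) (Q (tens\<^sub>1 x g')) = cinner g (bop_apply b g')"
      using M1.B_star[OF \<psi>_in] by blast
  qed
  then obtain S\<^sub>0 where S\<^sub>0: "\<And>x g. x \<in> X\<^sub>1 \<Longrightarrow> Q (tens\<^sub>1 x g) = tens\<^sub>2 (S\<^sub>0 x) g"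
    by metis
  have "\<exists>z. \<forall>g. V (tens\<^sub>2 x g) = tens\<^sub>1 z g" for x
  proof (rule M1.operator_eq_tens_if_coefficients_in_algebra[OF V_tens_clinear V_tens_bound V(3)])
    fix x' assume x': "x' \<in> X\<^sub>1"
    have "cinner (tens\<^sub>1 x' g) (V (tens\<^sub>2 x g')) = cinner g (bop_apply (ip\<^sub>2 (S\<^sub>0 x') x) g')" for g g'
      by (simp add: S\<^sub>0[OF x'] M2.tens_inner flip: QV)
    then show "\<exists>b\<in>B. \<forall>g g'. cinner (tens\<^sub>1 x' g) (V (tens\<^sub>2 x g')) = cinner g (bop_apply b g')"
      using M2.ip_in by blast
  qed
  then obtain T where T: "\<And>x g. V (tens\<^sub>2 x g) = tens\<^sub>1 (T x) g"
    by metis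
  have "\<exists>z. \<forall>g. Q (tens\<^sub>1 x g) = tens\<^sub>2 z g" for x
  proof (rule M2.operator_eq_tens_if_coefficients_in_algebra[OF Q_tens_clinear Q_tens_bound Q(3)])
    fix x' assume "x' \<in> X\<^sub>2"
    have "cinner (tens\<^sub>2 x' g) (Q (tens\<^sub>1 x g')) = cinner g (bop_apply (ip\<^sub>1 (T x') x) g')" for g g'
      by (simp add: T M1.tens_inner flip: VQ)
    then show "\<exists>b\<in>B. \<forall>g g'. cinner (tens\<^sub>2 x' g) (Q (tens\<^sub>1 x g')) = cinner g (bop_apply b g')"
      using M1.ip_in by blast
  qed
  then obtain S where S: "\<And>x g. Q (tens\<^sub>1 x g) = tens\<^sub>2 (S x) g"
    by metis

  have adj: "ip\<^sub>1 (T x) z = ip\<^sub>2 x (S z)" for x z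
    by (rule bop_eqI_cinner) (simp add: VQ flip: M1.tens_inner M2.tens_inner T S)
  have T_kernel: "ip\<^sub>1 (lact\<^sub>1 a y\<^sub>1) (T (lact\<^sub>2 a' y\<^sub>2)) = \<psi> (star a * a')" for a a'
    by (rule bop_eqI_cinner) (simp add: V_kernel flip: M1.tens_inner T)
  have T_add: "T (x + y) = T x + T y" for x y
    by (rule M1.tens_eqI)
      (simp add: clinear_add[OF M1.tens_clinear_left] clinear_add[OF M2.tens_clinear_left]
        clinear_add[OF V(1)] flip: T)
  have T_scaleC: "T (c *\<^sub>C x) = c *\<^sub>C T x" for c x
    by (rule M1.tens_eqI)
      (simp add: clinear_scaleC[OF M1.tens_clinear_left] clinear_scaleC[OF M2.tens_clinear_left]
        clinear_scaleC[OF V(1)] flip: T)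
  have T_ract: "T (ract\<^sub>2 x b) = ract\<^sub>1 (T x) b" if "b \<in> B" for x b
    by (rule M1.tens_eqI) (simp add: that M1.tens_ract M2.tens_ract flip: T)
  have T_norm: "norm (T x) \<le> norm x" for x
    by (rule M1.norm_le_if_norm_tens_le) (simp_all add: V_tens_bound flip: T)

  \<comment> \<open>Intertwining holds between generators by the formula for the kernel. It extends to \<open>S\<close> on \<open>X\<^sub>1\<close>, since
    both sides lie in the closed span of \<open>X\<^sub>2 \<odot> \<G>\<close>, and from there to \<open>T\<close> on all of \<open>F\<^sub>2\<close>.\<close>
  have S_lact: "S (lact\<^sub>1 (star a) x) = lact\<^sub>2 (star a) (S x)" if x: "x \<in> X\<^sub>1" for a x
  proof (rule M2.tens_eqI, rule closure_cspan_eqI[where X = "{tens\<^sub>2 x g | x g. x \<in> X\<^sub>2}"])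
    fix g
    show "tens\<^sub>2 (S (lact\<^sub>1 (star a) x)) g \<in> closure (cspan {tens\<^sub>2 x g | x g. x \<in> X\<^sub>2})"
      unfolding S[symmetric] by (rule Q(3))
    show "tens\<^sub>2 (lact\<^sub>2 (star a) (S x)) g \<in> closure (cspan {tens\<^sub>2 x g | x g. x \<in> X\<^sub>2})"
      by (rule M2.lact_invariant_range) (simp_all only: X2_lact S[symmetric] Q(3))
    fix h assume "h \<in> {tens\<^sub>2 x g | x g. x \<in> X\<^sub>2}"
    then obtain a\<^sub>1 a\<^sub>2 g' where a: "x = lact\<^sub>1 a\<^sub>1 y\<^sub>1" "h = tens\<^sub>2 (lact\<^sub>2 a\<^sub>2 y\<^sub>2) g'"
      using x by (auto simp: X\<^sub>1_def X\<^sub>2_def)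
    have "ip\<^sub>2 (lact\<^sub>2 a\<^sub>2 y\<^sub>2) (S (lact\<^sub>1 (star a) x)) = star (\<psi> (star (star a * a\<^sub>1) * a\<^sub>2))"
      unfolding adj[symmetric] M1.ip_star[symmetric, of "T _"] a(1) M1.lact_mult[symmetric] T_kernel ..
    also have "\<dots> = star (\<psi> (star a\<^sub>1 * (a * a\<^sub>2)))"
      by (simp add: star_mult star_star mult.assoc)
    also have "\<dots> = ip\<^sub>2 (lact\<^sub>2 a\<^sub>2 y\<^sub>2) (lact\<^sub>2 (star a) (S x))"
      unfolding M2.lact_star[symmetric] adj[symmetric] M1.ip_star[symmetric, of "T _"] a(1)
        M2.lact_mult[symmetric] T_kernel ..
    finally show "cinner h (tens\<^sub>2 (S (lact\<^sub>1 (star a) x)) g) = cinner h (tens\<^sub>2 (lact\<^sub>2 (star a) (S x)) g)"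
      by (simp add: a(2) M2.tens_inner)
  qed
  have T_lact: "T (lact\<^sub>2 a x) = lact\<^sub>1 a (T x)" for a x
  proof (rule M1.tens_eqI, rule closure_cspan_eqI[where X = "{tens\<^sub>1 x g | x g. x \<in> X\<^sub>1}"])
    fix g
    show "tens\<^sub>1 (T (lact\<^sub>2 a x)) g \<in> closure (cspan {tens\<^sub>1 x g | x g. x \<in> X\<^sub>1})"
      unfolding T[symmetric] by (rule V(3))
    show "tens\<^sub>1 (lact\<^sub>1 a (T x)) g \<in> closure (cspan {tens\<^sub>1 x g | x g. x \<in> X\<^sub>1})"
      by (rule M1.lact_invariant_range) (simp_all only: X1_lact T[symmetric] V(3))
    fix h assume "h \<in> {tens\<^sub>1 x g | x g. x \<in> X\<^sub>1}"
    then obtain z g' where z: "z \<in> X\<^sub>1" "h = tens\<^sub>1 z g'"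
      by blast
    have "ip\<^sub>1 (T (lact\<^sub>2 a x)) z = ip\<^sub>1 (lact\<^sub>1 a (T x)) z"
      by (simp only: adj M2.lact_star M1.lact_star S_lact[OF z(1)])
    then have "ip\<^sub>1 z (T (lact\<^sub>2 a x)) = ip\<^sub>1 z (lact\<^sub>1 a (T x))"
      by (metis M1.ip_star)
    then show "cinner h (tens\<^sub>1 (T (lact\<^sub>2 a x)) g) = cinner h (tens\<^sub>1 (lact\<^sub>1 a (T x)) g)"
      by (simp add: z(2) M1.tens_inner)
  qed

  have "adjointable ip\<^sub>2 ip\<^sub>1 T"
    unfolding adjointable_def using adj by blast
  moreover have "bilinear_map B ract\<^sub>2 lact\<^sub>2 ract\<^sub>1 lact\<^sub>1 T"
    by (simp add: bilinear_map_def clinear_iff T_add T_scaleC T_lact T_ract)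
  moreover have "\<psi> a = ip\<^sub>1 y\<^sub>1 (T (lact\<^sub>2 a y\<^sub>2))" for a
    using T_kernel[of 1 a] by (simp add: M1.lact_one star_one)
  ultimately show ?thesis
    using T_norm by blast
qed

end
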